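(* Let $d\in[1,+\infty]$ and let $(\varphi_{s,t})_{0\le s\le t<+\infty}$ be an evolution family of order $d$ in the unit disc $\mathbb{D}$. (1) For every $s\ge0$ there exists a set $M(s)\subset[s,+\infty)$ of zero measure (not depending on $z$) such that, for every $t\in(s,+\infty)\setminus M(s)$, the function $$\mathbb{D}\ni z\mapsto\frac{\partial\varphi_{s,t}(z)}{\partial t}=\lim_{h\to0}\frac{\varphi_{s,t+h}(z)-\varphi_{s,t}(z)}{h}\in\mathbb{C}$$ is a well-defined holomorphic function on $\mathbb{D}$. (2) Let $G:\mathbb{D}\times[0,+\infty)\to\mathbb{C}$ be a Herglotz vector field whose positive trajectories are $(\varphi_{s,t})$. Fix $s\ge0$. Then there exists a set $M(s)\subset[s,+\infty)$ of zero measure (not depending on $z$) such that, for every $t\in(s,+\infty)\setminus M(s)$ and every $z\in\mathbb{D}$, $$\frac{\partial\varphi_{s,t}(z)}{\partial t}=G(\varphi_{s,t}(z),t).$$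
   Context: $\mathbb{D}=\{\zeta\in\mathbb{C}:|\zeta|<1\}$. Evolution family: for $d\in[1,+\infty]$, a family $(\varphi_{s,t})_{0\le s\le t<+\infty}$ of holomorphic self-maps of $\mathbb{D}$ is an evolution family of order $d$ if (1) $\varphi_{s,s}=\mathrm{id}_{\mathbb{D}}$ for all $s\ge 0$; (2) $\varphi_{s,t}=\varphi_{u,t}\circ\varphi_{s,u}$ for all $0\le s\le u\le t<+\infty$; (3) for all $z\in\mathbb{D}$ and all $T>0$ there is a non-negative $k_{z,T}\in L^d([0,T],\mathbb{R})$ with $|\varphi_{s,u}(z)-\varphi_{s,t}(z)|\le\int_u^t k_{z,T}(\xi)\,d\xi$ for all $0\le s\le u\le t\le T$. Infinitesimal generator: a semigroup of holomorphic self-maps of $\mathbb{D}$ is a family $(\phi_t)_{t\ge0}$ of holomorphic self-maps of $\mathbb{D}$ with $\phi_0=\mathrm{id}$, $\phi_{t+s}=\phi_t\circ\phi_s$, and $\phi_t\to\mathrm{id}$ uniformly on compact sets as $t\to0$; its infinitesimal generator is the unique holomorphic $F:\mathbb{D}\to\mathbb{C}$ with $\frac{\partial\phi_t(z)}{\partial t}=F(\phi_t(z))$ for all $z\in\mathbb{D}$, $t\ge0$. $\mathrm{Gen}(\mathbb{D})$ denotes the set of all such generators. Herglotz vector field: a weak holomorphic vector field of order $d\in[1,+\infty]$ on $\mathbb{D}$ is a function $G:\mathbb{D}\times[0,+\infty)\to\mathbb{C}$ such that $t\mapsto G(z,t)$ is measurable for every $z\in\mathbb{D}$, $z\mapsto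 G(z,t)$ is holomorphic for every $t\ge0$, and for every compact $K\subset\mathbb{D}$ and $T>0$ there is a non-negative $k_{K,T}\in L^d([0,T],\mathbb{R})$ with $|G(z,t)|\le k_{K,T}(t)$ for all $z\in K$ and a.e. $t\in[0,T]$. It is a Herglotz vector field (of order $d$) if moreover $G(\cdot,t)\in\mathrm{Gen}(\mathbb{D})$ for almost every $t\in[0,+\infty)$. The positive trajectories of $G$ are $(\varphi_{s,t})$ if for every $(z,s)\in\mathbb{D}\times[0,+\infty)$ the function $x(t)=\varphi_{s,t}(z)$, $t\in[s,+\infty)$, is locally absolutely continuous, $x(s)=z$, and $\dot x(t)=G(x(t),t)$ for a.e. $t\in[s,+\infty)$ (the exceptional null set being allowed to depend on $z$ and $s$). *)

theory Defs
  imports "HOL-Complex_Analysis.Complex_Analysis"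
begin

abbreviation unit_disc :: "complex set"
  where "unit_disc \<equiv> ball 0 1"

definition holomorphic_self_map :: "(complex \<Rightarrow> complex) \<Rightarrow> bool" where
  "holomorphic_self_map f \<longleftrightarrow> f holomorphic_on unit_disc \<and> f ` unit_disc \<subseteq> unit_disc"

(* Meant for d \<ge> 1; only the values of k on [0,T] matter. *)
definition Ld_on :: "ennreal \<Rightarrow> real \<Rightarrow> (real \<Rightarrow> real) \<Rightarrow> bool" where
  "Ld_on d T k \<longleftrightarrow>
     k \<in> borel_measurable (lebesgue_on {0..T}) \<and>
     (if d = \<infinity> then \<exists>C. AE \<xi> in lebesgue_on {0..T}. \<bar>k \<xi>\<bar> \<le> C
      else integrable (lebesgue_on {0..T}) (\<lambda>\<xi>. \<bar>k \<xi>\<bar> powr enn2real d))"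

(* The values \<phi> s t are irrelevant unless 0 \<le> s \<le> t, as are those of \<phi> s t outside the disc. *)
definition evolution_family :: "ennreal \<Rightarrow> (real \<Rightarrow> real \<Rightarrow> complex \<Rightarrow> complex) \<Rightarrow> bool" where
  "evolution_family d \<phi> \<longleftrightarrow>
     (\<forall>s t. 0 \<le> s \<and> s \<le> t \<longrightarrow> holomorphic_self_map (\<phi> s t)) \<and>
     (\<forall>s\<ge>0. \<forall>z\<in>unit_disc. \<phi> s s z = z) \<and>
     (\<forall>s u t. 0 \<le> s \<and> s \<le> u \<and> u \<le> t \<longrightarrow> (\<forall>z\<in>unit_disc. \<phi> s t z = \<phi> u t (\<phi> s u z))) \<and>
     (\<forall>z\<in>unit_disc. \<forall>T>0. \<exists>k.
        Ld_on d T k \<and> (\<forall>\<xi>\<in>{0..T}. 0 \<le> k \<xi>) \<and>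
        (\<forall>s u t. 0 \<le> s \<and> s \<le> u \<and> u \<le> t \<and> t \<le> T \<longrightarrow>
           cmod (\<phi> s u z - \<phi> s t z) \<le> (LINT \<xi>|lebesgue_on {u..t}. k \<xi>)))"

definition holomorphic_semigroup :: "(real \<Rightarrow> complex \<Rightarrow> complex) \<Rightarrow> bool" where
  "holomorphic_semigroup \<phi> \<longleftrightarrow>
     (\<forall>t\<ge>0. holomorphic_self_map (\<phi> t)) \<and>
     (\<forall>z\<in>unit_disc. \<phi> 0 z = z) \<and>
     (\<forall>s\<ge>0. \<forall>t\<ge>0. \<forall>z\<in>unit_disc. \<phi> (t + s) z = \<phi> t (\<phi> s z)) \<and>
     (\<forall>K. compact K \<and> K \<subseteq> unit_disc \<longrightarrow> uniform_limit K \<phi> (\<lambda>z. z) (at_right 0))"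

(* The time derivative at t = 0 is one-sided. *)
definition infinitesimal_generator ::
    "(real \<Rightarrow> complex \<Rightarrow> complex) \<Rightarrow> (complex \<Rightarrow> complex) \<Rightarrow> bool" where
  "infinitesimal_generator \<phi> F \<longleftrightarrow>
     F holomorphic_on unit_disc \<and>
     (\<forall>z\<in>unit_disc. \<forall>t\<ge>0.
        ((\<lambda>\<tau>. \<phi> \<tau> z) has_vector_derivative F (\<phi> t z)) (at t within {0..}))"

definition Gen :: "(complex \<Rightarrow> complex) set" where
  "Gen = {F. \<exists>\<phi>. holomorphic_semigroup \<phi> \<and> infinitesimal_generator \<phi> F}"

definition weak_holomorphic_vector_field :: "ennreal \<Rightarrow> (complex \<Rightarrow> real \<Rightarrow> complex) \<Rightarrow> bool" where
  "weak_holomorphic_vector_field d G \<longleftrightarrow>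
     (\<forall>z\<in>unit_disc. (\<lambda>t. G z t) \<in> borel_measurable (lebesgue_on {0..})) \<and>
     (\<forall>t\<ge>0. (\<lambda>z. G z t) holomorphic_on unit_disc) \<and>
     (\<forall>K. compact K \<and> K \<subseteq> unit_disc \<longrightarrow> (\<forall>T>0. \<exists>k.
        Ld_on d T k \<and> (\<forall>\<xi>\<in>{0..T}. 0 \<le> k \<xi>) \<and>
        (\<forall>z\<in>K. AE t in lebesgue_on {0..T}. cmod (G z t) \<le> k t)))"

definition herglotz_vector_field :: "ennreal \<Rightarrow> (complex \<Rightarrow> real \<Rightarrow> complex) \<Rightarrow> bool" where
  "herglotz_vector_field d G \<longleftrightarrow>
     weak_holomorphic_vector_field d G \<and>
     (AE t in lebesgue_on {0..}. (\<lambda>z. G z t) \<in> Gen)"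

(* Absolute continuity of a function on [a,b], not of one measure with respect to another. *)
definition abs_continuous_on_interval :: "real \<Rightarrow> real \<Rightarrow> (real \<Rightarrow> complex) \<Rightarrow> bool" where
  "abs_continuous_on_interval a b x \<longleftrightarrow>
     (\<forall>\<epsilon>>0. \<exists>\<delta>>0. \<forall>(n::nat) l r.
        (\<forall>i<n. a \<le> l i \<and> l i \<le> r i \<and> r i \<le> b) \<and>
        disjoint_family_on (\<lambda>i. {l i<..<r i}) {..<n} \<and>
        (\<Sum>i<n. r i - l i) < \<delta> \<longrightarrow>
        (\<Sum>i<n. cmod (x (r i) - x (l i))) < \<epsilon>)"

(* The null set implicit in AE may depend on both z and s. *)
definition positive_trajectories ::
    "(complex \<Rightarrow> real \<Rightarrow> complex) \<Rightarrow> (real \<Rightarrow> real \<Rightarrow> complex \<Rightarrow> complex) \<Rightarrow> bool" where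
  "positive_trajectories G \<phi> \<longleftrightarrow>
     (\<forall>z\<in>unit_disc. \<forall>s\<ge>0.
        (\<forall>t\<ge>s. \<phi> s t z \<in> unit_disc) \<and>
        (\<forall>T\<ge>s. abs_continuous_on_interval s T (\<lambda>t. \<phi> s t z)) \<and>
        \<phi> s s z = z \<and>
        (AE t in lebesgue_on {s..}.
           ((\<lambda>\<tau>. \<phi> s \<tau> z) has_vector_derivative G (\<phi> s t z) t) (at t within {s..})))"

end

theory Submission
  imports Defs "HOL-Probability.Distribution_Functions"
begin

text \<open>
For a fixed point \<open>z\<close> the orbit \<open>\<tau> \<mapsto> \<phi> s \<tau> z\<close> has increments dominated by the integral of an integrable
function, so it is differentiable off a null set depending on \<open>z\<close>. The difficulty is to find one null
set for all \<open>z\<close>. A countable dense set of points costs only one null set, so it remains to pass from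
a dense set to the whole disc, which is what the Vitali--Porter theorem does
(\<open>vitali_porter_at_0\<close>) once the difference quotients are known to be locally bounded in \<open>z\<close>,
for fixed \<open>t\<close> and all small \<open>h\<close>.

Local boundedness comes from rigidity of self-maps of the disc. By the semigroup-like law,
\<open>\<phi> s (t + h) z - \<phi> s t z\<close> is the displacement \<open>f w - w\<close> of the point \<open>w = \<phi> s t z\<close> under \<open>f = \<phi> t (t + h)\<close>
(and similarly for negative \<open>h\<close>). The displacement of a self-map on a compact set is bounded
by a constant times its displacements at the two points \<open>0\<close> and \<open>1/2\<close>; this is Harnack's inequality
combined with the Schwarz lemma (\<open>self_map_displacement_bound\<close>). At these two points the displacement
is \<open>O(h)\<close> whenever \<open>t\<close> is a point of differentiability of the dominating integrals, that is, for almost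
every \<open>t\<close> (\<open>displacement_rate_ae\<close>).

On the real-variable side, a function whose increments are dominated by an absolutely continuous
finite measure is differentiable almost everywhere (\<open>dominated_differentiable_ae\<close>): Radon--Nikodym
turns it into an indefinite integral, and Lebesgue's differentiation theorem applies.

For the second part, the derivative found in the first part is holomorphic in \<open>z\<close>, and so is
\<open>z \<mapsto> G (\<phi> s t z) t\<close>. Off countably many null sets they agree on a countable dense set, hence everywhere.
\<close>

section \<open>Holomorphic self-maps of the disc\<close>

text \<open>
The Cayley-type quotient \<open>(q z - q 0) / (q z + cnj (q 0))\<close> maps the disc into itself, since \<open>q\<close> takes
values in the right half-plane, and it vanishes at the origin. The Schwarz lemma therefore bounds it by
\<open>\<bar>z\<bar>\<close>; solving for \<open>q z\<close> gives both inequalities.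
\<close>

lemma harnack_strict:
  assumes q: "q holomorphic_on ball 0 1" and pos: "\<And>z. z \<in> ball 0 1 \<Longrightarrow> 0 < Re (q z)"
    and z: "cmod z < 1"
  shows "cmod (q z) * (1 - cmod z) \<le> cmod (q 0) * (1 + cmod z)"
    and "cmod (q 0) * (1 - cmod z) \<le> cmod (q z) * (1 + cmod z)"
proof -
  define w where "w = (\<lambda>z. (q z - q 0) / (q z + cnj (q 0)))"
  have nz: "q z + cnj (q 0) \<noteq> 0" if "z \<in> ball 0 1" for z
  proof -
    have "Re (q z + cnj (q 0)) > 0"
      using pos[OF that] pos[of 0] by simp
    then show ?thesis by (metis less_irrefl zero_complex.sel(1))
  qed
  have le: "cmod (w z) \<le> cmod z"
  proof (rule Schwarz_Lemma(1))
    show "w holomorphic_on ball 0 1"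
      unfolding w_def using nz by (intro holomorphic_intros q) auto
    show "w 0 = 0" by (simp add: w_def)
    show "cmod (w z) < 1" if "cmod z < 1" for z
    proof -
      have "0 < Re (q z) * Re (q 0)"
        using pos[of z] pos[of 0] that by simp
      then have "(cmod (q z - q 0))\<^sup>2 < (cmod (q z + cnj (q 0)))\<^sup>2"
        by (simp add: cmod_power2) (simp add: power2_eq_square algebra_simps)
      then have "cmod (q z - q 0) < cmod (q z + cnj (q 0))"
        by (rule power2_less_imp_less) simp
      then show ?thesis
        using nz[of z] that by (simp add: w_def norm_divide divide_simps)
    qed
  qed (use z in auto)
  have eq: "q z * (1 - w z) = q 0 + w z * cnj (q 0)"
    using nz[of z] z by (simp add: w_def field_simps)
  show "cmod (q z) * (1 - cmod z) \<le> cmod (q 0) * (1 + cmod z)"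
  proof -
    have "cmod (q z) * (1 - cmod z) \<le> cmod (q z) * cmod (1 - w z)"
      using le norm_triangle_ineq2[of 1 "w z"] by (intro mult_left_mono) auto
    also have "\<dots> = cmod (q 0 + w z * cnj (q 0))"
      by (metis eq norm_mult)
    also have "\<dots> \<le> cmod (q 0) + cmod (w z) * cmod (q 0)"
      using norm_triangle_ineq[of "q 0" "w z * cnj (q 0)"] by (simp add: norm_mult)
    also have "\<dots> \<le> cmod (q 0) * (1 + cmod z)"
      using mult_right_mono[OF le, of "cmod (q 0)"] by (simp add: algebra_simps)
    finally show ?thesis .
  qed
  show "cmod (q 0) * (1 - cmod z) \<le> cmod (q z) * (1 + cmod z)"
  proof -
    have "cmod (q 0) * (1 - cmod z) \<le> cmod (q 0) - cmod (w z) * cmod (q 0)"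
      using mult_right_mono[OF le, of "cmod (q 0)"] by (simp add: algebra_simps)
    also have "\<dots> \<le> cmod (q 0 + w z * cnj (q 0))"
      using norm_diff_ineq[of "q 0" "w z * cnj (q 0)"] by (simp add: norm_mult)
    also have "\<dots> = cmod (q z) * cmod (1 - w z)"
      by (metis eq norm_mult)
    also have "\<dots> \<le> cmod (q z) * (1 + cmod z)"
      using le norm_triangle_ineq4[of 1 "w z"] by (intro mult_left_mono) auto
    finally show ?thesis .
  qed
qed

text \<open>
Adding a small positive constant to \<open>q\<close> reduces this to the strict case. The boundary case
\<open>Re q = 0\<close> occurs below for \<open>q = 1 - p\<close>, where \<open>p\<close> may be the constant \<open>1\<close>.
\<close>

lemma harnack:
  assumes q: "q holomorphic_on ball 0 1" and nonneg: "\<And>z. z \<in> ball 0 1 \<Longrightarrow> 0 \<le> Re (q z)"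
    and z: "cmod z < 1"
  shows "cmod (q z) * (1 - cmod z) \<le> cmod (q 0) * (1 + cmod z)"
    and "cmod (q 0) * (1 - cmod z) \<le> cmod (q z) * (1 + cmod z)"
proof -
  have lim: "((\<lambda>\<epsilon>. cmod (q v + complex_of_real \<epsilon>) * c) \<longlongrightarrow> cmod (q v) * c) (at_right 0)" for v c
    by (auto intro!: tendsto_eq_intros)
  have hol: "(\<lambda>z. q z + complex_of_real \<epsilon>) holomorphic_on ball 0 1" for \<epsilon>
    by (intro holomorphic_intros q)
  have pos: "0 < Re (q v + complex_of_real \<epsilon>)" if "v \<in> ball 0 1" "0 < \<epsilon>" for v \<epsilon>
    using nonneg[of v] that by simp
  have ev: "eventually (\<lambda>\<epsilon>. \<epsilon> > (0::real)) (at_right 0)"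
    by (simp add: eventually_at_right_less)
  show "cmod (q z) * (1 - cmod z) \<le> cmod (q 0) * (1 + cmod z)"
    by (rule tendsto_le[OF _ lim lim]) 
       (auto intro!: eventually_mono[OF ev] harnack_strict(1)[OF hol pos z])
  show "cmod (q 0) * (1 - cmod z) \<le> cmod (q z) * (1 + cmod z)"
    by (rule tendsto_le[OF _ lim lim])
       (auto intro!: eventually_mono[OF ev] harnack_strict(2)[OF hol pos z])
qed

text \<open>
How far a self-map pushes a smaller disc towards the unit circle is controlled by the image of the
origin alone: Harnack's lower bound applies to \<open>1 - u f\<close>, where the unimodular \<open>u\<close> rotates
\<open>f z\<close> onto the positive axis, so that \<open>\<bar>1 - u f z\<bar> = 1 - \<bar>f z\<bar>\<close>.
\<close>

lemma self_map_image_bound: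
  assumes f: "holomorphic_self_map f" and a: "cmod (f 0) \<le> a" "a \<le> 1" and z: "cmod z \<le> r" "r < 1"
  shows "cmod (f z) \<le> 1 - (1 - a) * ((1 - r) / (1 + r))"
proof -
  have r0: "0 \<le> r" using z(1) norm_ge_zero order_trans by blast
  have z1: "cmod z < 1" using z by simp
  obtain u where u: "cmod u = 1" "u * f z = of_real (cmod (f z))"
  proof (cases "f z = 0")
    case True then show ?thesis using that[of 1] by simp
  next
    case False
    show ?thesis
      by (rule that[of "of_real (cmod (f z)) / f z"]) (use False in \<open>auto simp: norm_divide\<close>)
  qed
  have lt: "cmod (f v) < 1" if "cmod v < 1" for v
    using f that by (auto simp: holomorphic_self_map_def image_subset_iff)
  have hol: "(\<lambda>v. 1 - u * f v) holomorphic_on ball 0 1"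
    using f by (intro holomorphic_intros) (simp add: holomorphic_self_map_def)
  have re: "0 \<le> Re (1 - u * f v)" if "v \<in> ball 0 1" for v
  proof -
    have "Re (u * f v) \<le> cmod (u * f v)" by (rule complex_Re_le_cmod)
    then show ?thesis using lt[of v] that u by (simp add: norm_mult)
  qed
  have "(1 - a) * (1 - r) \<le> cmod (1 - u * f 0) * (1 - cmod z)"
    using a z norm_triangle_ineq2[of 1 "u * f 0"] u by (intro mult_mono) (auto simp: norm_mult)
  also have "\<dots> \<le> cmod (1 - u * f z) * (1 + cmod z)"
    using harnack(2)[OF hol re z1] by simp
  also have "1 - u * f z = of_real (1 - cmod (f z))" using u by simp
  also have "cmod (of_real (1 - cmod (f z))) = 1 - cmod (f z)"
    using lt[OF z1] by (simp only: norm_of_real)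
  also have "(1 - cmod (f z)) * (1 + cmod z) \<le> (1 - cmod (f z)) * (1 + r)"
    using lt[OF z1] z by (intro mult_left_mono) auto
  finally show ?thesis using r0 by (simp add: field_simps)
qed

text \<open>
A self-map that moves two points only a little is close to the identity on compact sets, and the
dependence is linear. If \<open>f\<close> fixes the origin, then \<open>f z = z p(z)\<close> with \<open>\<bar>p\<bar> \<le> 1\<close>, so \<open>1 - p\<close> has
nonnegative real part and Harnack compares its values at \<open>z\<close>, at \<open>0\<close> and at \<open>1/2\<close>. In general one
first composes \<open>f\<close> with the automorphism of the disc that sends \<open>a = f 0\<close> back to the origin; this
changes the displacement of any point by at most \<open>2\<bar>a\<bar>\<close>. Linearity is what makes the bound
useful: it turns a rate \<open>O(h)\<close> at two points into a rate \<open>O(h)\<close> on compact sets.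
\<close>

lemma self_map_displacement_bound:
  assumes f: "holomorphic_self_map f" and z: "cmod z \<le> r" "r < 1"
  shows "cmod (f z - z) \<le> 14 * ((1 + r) / (1 - r)) * (cmod (f 0) + cmod (f (1/2) - 1/2))"
proof -
  have r0: "0 \<le> r" using z(1) norm_ge_zero order_trans by blast
  have z1: "cmod z < 1" using z by simp
  have lt: "cmod (f v) < 1" if "cmod v < 1" for v
    using f that by (auto simp: holomorphic_self_map_def image_subset_iff)
  define a where "a = f 0"
  have a1: "cmod a < 1" using lt[of 0] by (simp add: a_def)
  define g where "g = (\<lambda>v. Moebius_function 0 a (f v))"
  have g1: "cmod (g v) < 1" if "cmod v < 1" for v
    unfolding g_def by (rule Moebius_function_norm_lt_1[OF a1 lt[OF that]])
  have ghol: "g holomorphic_on ball 0 1"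
    using holomorphic_on_compose_gen[OF _ Moebius_function_holomorphic[OF a1], of f "ball 0 1" 0] f
    by (simp add: g_def o_def holomorphic_self_map_def)
  have g0: "g 0 = 0" by (simp add: g_def a_def Moebius_function_eq_zero)
  \<comment> \<open>Clearing the denominator of the Moebius map gives this without any lower bound on it.\<close>
  have fg: "cmod ((f v - v) - (g v - v)) \<le> 2 * cmod a" if "cmod v < 1" for v
  proof -
    have "cmod (cnj a * f v) < 1"
      using a1 lt[OF that] norm_mult_less[of "cnj a" 1 "f v" 1] by simp
    then have "1 - cnj a * f v \<noteq> 0" by auto
    then have "(f v - v) - (g v - v) = a - cnj a * f v * g v"
      by (simp add: g_def Moebius_function_simple field_simps)
    also have "cmod \<dots> \<le> cmod a + cmod a * (cmod (f v) * cmod (g v))"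
      using norm_triangle_ineq4[of a "cnj a * f v * g v"] by (simp add: norm_mult mult.assoc)
    also have "\<dots> \<le> cmod a + cmod a * (1 * 1)"
      using lt[OF that] g1[OF that] by (intro add_left_mono mult_left_mono mult_mono) auto
    finally show ?thesis by simp
  qed
  obtain p where p: "p holomorphic_on ball 0 1" "\<And>v. cmod v < 1 \<Longrightarrow> g v = v * p v"
      "deriv g 0 = p 0"
    by (rule Schwarz3[OF ghol g0]) auto
  have p1: "cmod (p v) \<le> 1" if "cmod v < 1" for v
  proof (cases "v = 0")
    case True
    then show ?thesis using Schwarz_Lemma(2)[OF ghol g0 g1 that] p(3) by simp
  next
    case False
    have "cmod (g v) \<le> cmod v" by (rule Schwarz_Lemma(1)[OF ghol g0 g1 that])
    then show ?thesis using False p(2)[OF that] by (simp add: norm_mult)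
  qed
  have hol: "(\<lambda>v. 1 - p v) holomorphic_on ball 0 1" by (intro holomorphic_intros p)
  have re: "0 \<le> Re (1 - p v)" if "v \<in> ball 0 1" for v
    using p1[of v] that complex_Re_le_cmod[of "p v"] by simp
  define R where "R = (1 + r) / (1 - r)"
  have R1: "1 \<le> R" using r0 z by (simp add: R_def field_simps)
  have "cmod (1 - p z) \<le> R * cmod (1 - p 0)"
  proof -
    have "cmod (1 - p z) * (1 - r) \<le> cmod (1 - p z) * (1 - cmod z)"
      using z by (intro mult_left_mono) auto
    also have "\<dots> \<le> cmod (1 - p 0) * (1 + cmod z)" by (rule harnack(1)[OF hol re z1])
    also have "\<dots> \<le> cmod (1 - p 0) * (1 + r)" using z by (intro mult_left_mono) auto
    finally show ?thesis using z by (simp add: R_def field_simps)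
  qed
  moreover have "cmod (1 - p 0) \<le> 3 * cmod (1 - p (1/2))"
    using harnack(2)[OF hol re, of "1/2"] by (simp add: field_simps)
  moreover have "cmod (g (1/2) - 1/2) = cmod (1 - p (1/2)) / 2"
  proof -
    have "g (1/2) - 1/2 = - ((1 - p (1/2)) / 2)"
      using p(2)[of "1/2"] by (simp add: field_simps)
    then show ?thesis by (metis norm_minus_cancel norm_divide norm_numeral)
  qed
  moreover have "cmod (g (1/2) - 1/2) \<le> cmod (f (1/2) - 1/2) + 2 * cmod a"
    using fg[of "1/2"] norm_triangle_ineq2[of "g (1/2) - 1/2" "f (1/2) - 1/2"]
    by (simp add: norm_minus_commute)
  ultimately have "cmod (1 - p z) \<le> R * cmod (1 - p 0)"
      "cmod (1 - p 0) \<le> 6 * (cmod (f (1/2) - 1/2) + 2 * cmod a)"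
    by (auto simp: mult.commute intro: order_trans)
  then have "cmod (1 - p z) \<le> R * (6 * (cmod (f (1/2) - 1/2) + 2 * cmod a))"
    using R1 by (meson mult_left_mono order_trans zero_le_one)
  moreover have "cmod (g z - z) \<le> cmod (1 - p z)"
  proof -
    have "g z - z = - (z * (1 - p z))" using p(2)[OF z1] by (simp add: algebra_simps)
    then have "cmod (g z - z) = cmod z * cmod (1 - p z)" by (metis norm_minus_cancel norm_mult)
    then show ?thesis using z1 by (simp add: mult_left_le_one_le)
  qed
  moreover have "cmod (f z - z) \<le> cmod (g z - z) + 2 * cmod a"
    using fg[OF z1] norm_triangle_ineq2[of "f z - z" "g z - z"] by simp
  moreover have "2 * cmod a \<le> R * (2 * cmod a)"
    using R1 mult_right_mono[of 1 R "2 * cmod a"] by simp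
  ultimately have "cmod (f z - z) \<le> R * (6 * (cmod (f (1/2) - 1/2) + 2 * cmod a)) + R * (2 * cmod a)"
    by linarith
  also have "\<dots> = R * (6 * cmod (f (1/2) - 1/2) + 14 * cmod a)"
    by (simp add: algebra_simps)
  also have "\<dots> \<le> R * (14 * (cmod a + cmod (f (1/2) - 1/2)))"
    using R1 by (intro mult_left_mono) auto
  finally show ?thesis by (simp only: R_def a_def mult.commute[of R] mult.assoc) (simp add: ac_simps)
qed

section \<open>Convergence of locally bounded families\<close>

lemma holomorphic_eq_of_dense:
  assumes f: "f holomorphic_on S" and g: "g holomorphic_on S"
    and Q: "Q \<subseteq> S" "S \<subseteq> closure Q" and eq: "\<And>q. q \<in> Q \<Longrightarrow> f q = g q" and z: "z \<in> S"
  shows "f z = g z"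
proof -
  obtain \<sigma> where \<sigma>: "\<And>n. \<sigma> n \<in> Q" "\<sigma> \<longlonglongrightarrow> z"
    using z Q(2) closure_sequential by (metis subsetD)
  have "(\<lambda>n. h (\<sigma> n)) \<longlonglongrightarrow> h z" if "h holomorphic_on S" for h
    using holomorphic_on_imp_continuous_on[OF that] \<sigma> z Q
    by (intro continuous_on_tendsto_compose[of S h]) (auto intro!: always_eventually)
  from this[OF f] this[OF g] show ?thesis
    using eq[OF \<sigma>(1)] LIMSEQ_unique by auto
qed

text \<open>
The Vitali--Porter theorem for a family indexed by a real parameter tending to \<open>0\<close>. By Montel's
theorem every sequence of parameters has a subsequence along which the family converges to a
holomorphic function; all these limits agree on the dense set \<open>Q\<close> and hence everywhere, so the
whole family converges.
\<close>

lemma vitali_porter_at_0: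
  fixes D :: "real \<Rightarrow> complex \<Rightarrow> complex"
  assumes S: "open S" and \<delta>: "0 < \<delta>"
    and hol: "\<And>h. 0 < \<bar>h\<bar> \<Longrightarrow> \<bar>h\<bar> < \<delta> \<Longrightarrow> D h holomorphic_on S"
    and bdd: "\<And>K. compact K \<Longrightarrow> K \<subseteq> S \<Longrightarrow>
      \<exists>B. \<forall>h. 0 < \<bar>h\<bar> \<and> \<bar>h\<bar> < \<delta> \<longrightarrow> (\<forall>z\<in>K. cmod (D h z) \<le> B)"
    and Q: "Q \<subseteq> S" "S \<subseteq> closure Q"
    and lim: "\<And>q. q \<in> Q \<Longrightarrow> \<exists>l. ((\<lambda>h. D h q) \<longlongrightarrow> l) (at 0)"
  obtains f where "f holomorphic_on S" "\<And>z. z \<in> S \<Longrightarrow> ((\<lambda>h. D h z) \<longlongrightarrow> f z) (at 0)"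
proof -
  have subseq: "\<exists>g r. g holomorphic_on S \<and> strict_mono (r :: nat \<Rightarrow> nat) \<and>
      (\<forall>z\<in>S. (\<lambda>n. D (X (r n)) z) \<longlonglongrightarrow> g z)"
    if X: "\<And>n. 0 < \<bar>X n\<bar>" "\<And>n. \<bar>X n\<bar> < \<delta>" for X :: "nat \<Rightarrow> real"
  proof -
    let ?H = "D ` {h. 0 < \<bar>h\<bar> \<and> \<bar>h\<bar> < \<delta>}"
    have b: "\<exists>B. \<forall>h\<in>?H. \<forall>z\<in>K. cmod (h z) \<le> B" if "compact K" "K \<subseteq> S" for K
      using bdd[OF that] by auto
    have rng: "range (\<lambda>n. D (X n)) \<subseteq> ?H" using X by auto
    obtain g r where "g holomorphic_on S" "strict_mono (r :: nat \<Rightarrow> nat)"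
        "\<And>x. x \<in> S \<Longrightarrow> ((\<lambda>n. D (X (r n)) x) \<longlongrightarrow> g x) sequentially"
      by (rule Montel[OF S _ b rng]) (use hol in auto)
    then show ?thesis by blast
  qed
  have atX: "filterlim (\<lambda>n. X (r n)) (at 0) sequentially"
    if "\<And>n. 0 < \<bar>X n\<bar>" "X \<longlonglongrightarrow> 0" "strict_mono r" for X :: "nat \<Rightarrow> real" and r :: "nat \<Rightarrow> nat"
    using that LIMSEQ_subseq_LIMSEQ[OF that(2,3)]
    by (auto simp: filterlim_at o_def intro!: always_eventually)
  define Y where "Y = (\<lambda>n. \<delta> / 2 * inverse (real (Suc n)))"
  have Y: "0 < \<bar>Y n\<bar>" "\<bar>Y n\<bar> < \<delta>" for n
    using \<delta> by (auto simp: Y_def field_simps intro!: add_pos_nonneg)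
  have Y0: "Y \<longlonglongrightarrow> 0"
    unfolding Y_def by (rule tendsto_mult_right_zero[OF LIMSEQ_inverse_real_of_nat])
  obtain f r where f: "f holomorphic_on S" "strict_mono r" "\<And>z. z \<in> S \<Longrightarrow> (\<lambda>n. D (Y (r n)) z) \<longlonglongrightarrow> f z"
    using subseq[of Y] Y by blast
  have "((\<lambda>h. D h z) \<longlongrightarrow> f z) (at 0)" if z: "z \<in> S" for z
  proof (rule ccontr)
    assume "\<not> ?thesis"
    then obtain e where e: "e > 0" "\<And>d. d > 0 \<Longrightarrow> \<exists>h. 0 < \<bar>h\<bar> \<and> \<bar>h\<bar> < d \<and> e \<le> dist (D h z) (f z)"
      unfolding tendsto_iff eventually_at by (force simp: not_less dist_norm)
    have "\<exists>h. 0 < \<bar>h\<bar> \<and> \<bar>h\<bar> < Y n \<and> e \<le> dist (D h z) (f z)" for n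
      using e(2)[of "Y n"] \<delta> by (simp add: Y_def)
    then obtain X where X: "\<And>n. 0 < \<bar>X n\<bar>" "\<And>n. \<bar>X n\<bar> < Y n" "\<And>n. e \<le> dist (D (X n) z) (f z)"
      by metis
    have X0: "X \<longlonglongrightarrow> 0"
      by (rule Lim_null_comparison[OF _ Y0]) (use X(2) in \<open>auto intro!: always_eventually less_imp_le\<close>)
    have "\<bar>X n\<bar> < \<delta>" for n using X(2)[of n] Y(2)[of n] by linarith
    then obtain g r' where g: "g holomorphic_on S" "strict_mono r'"
        "\<And>z. z \<in> S \<Longrightarrow> (\<lambda>n. D (X (r' n)) z) \<longlonglongrightarrow> g z"
      using subseq[of X] X by blast
    have eqQ: "f q = g q" if q: "q \<in> Q" for q
    proof -
      obtain l where l: "((\<lambda>h. D h q) \<longlongrightarrow> l) (at 0)" using lim q by blast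
      have "f q = l" "g q = l"
        using filterlim_compose[OF l atX[OF Y(1) Y0 f(2)]] filterlim_compose[OF l atX[OF X(1) X0 g(2)]]
          f(3) g(3) Q q LIMSEQ_unique by blast+
      then show ?thesis by simp
    qed
    have "f z = g z"
      by (rule holomorphic_eq_of_dense[OF f(1) g(1) Q eqQ z])
    then have "(\<lambda>n. dist (D (X (r' n)) z) (f z)) \<longlonglongrightarrow> 0"
      using g(3)[OF z] by (metis tendsto_dist_iff)
    then have "e \<le> 0"
      by (rule LIMSEQ_le_const) (use X(3) in auto)
    then show False using e by simp
  qed
  then show ?thesis using that f(1) by blast
qed

section \<open>Almost everywhere differentiability of dominated functions\<close>
lemma has_vector_derivative_iff_quotient:
  fixes x :: "real \<Rightarrow> 'a::real_normed_vector"
  shows "(x has_vector_derivative D) (at t) \<longleftrightarrow> ((\<lambda>h. (x (t + h) - x t) /\<^sub>R h) \<longlongrightarrow> D) (at 0)"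
proof -
  have "(x has_vector_derivative D) (at t) \<longleftrightarrow>
      ((\<lambda>h. norm (x (t + h) - x t - h *\<^sub>R D) / norm h) \<longlongrightarrow> 0) (at 0)"
    by (simp add: has_vector_derivative_def has_derivative_at bounded_linear_scaleR_left)
  also have "\<dots> \<longleftrightarrow> ((\<lambda>h. norm ((x (t + h) - x t) /\<^sub>R h - D)) \<longlongrightarrow> 0) (at 0)"
  proof (rule filterlim_cong[OF refl refl])
    have "norm (x (t + h) - x t - h *\<^sub>R D) / norm h = norm ((x (t + h) - x t) /\<^sub>R h - D)" if "h \<noteq> 0" for h
    proof -
      have "(x (t + h) - x t) /\<^sub>R h - D = (x (t + h) - x t - h *\<^sub>R D) /\<^sub>R h"
        using that by (simp add: scaleR_diff_right)
      then show ?thesis by (simp add: divide_inverse mult.commute)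
    qed
    then show "\<forall>\<^sub>F h in at 0. norm (x (t + h) - x t - h *\<^sub>R D) / norm h = norm ((x (t + h) - x t) /\<^sub>R h - D)"
      by (auto simp: eventually_at_filter)
  qed
  also have "\<dots> \<longleftrightarrow> ((\<lambda>h. (x (t + h) - x t) /\<^sub>R h) \<longlongrightarrow> D) (at 0)"
    by (simp only: tendsto_norm_zero_iff LIM_zero_iff)
  finally show ?thesis .
qed

text \<open>
Lebesgue's differentiation theorem in the one-sided form in which it holds for cubes with a given
corner.
\<close>

lemma indefinite_integral_right_derivative_ae:
  fixes F f :: "real \<Rightarrow> real"
  assumes F: "\<And>a b. a \<le> b \<Longrightarrow> (f has_integral (F b - F a)) {a..b}"
  obtains N where "negligible N"
    "\<And>t. t \<notin> N \<Longrightarrow> ((\<lambda>h. (F (t + h) - F t) / h) \<longlongrightarrow> f t) (at_right 0)"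
proof -
  have "f integrable_on cbox a b" for a b
  proof (cases "a \<le> b")
    case True then show ?thesis using F by auto
  qed auto
  then obtain N where N: "negligible N" and N': "\<And>x e. \<lbrakk>x \<notin> N; 0 < e\<rbrakk> \<Longrightarrow>
     \<exists>d>0. \<forall>h. 0 < h \<and> h < d \<longrightarrow>
       norm (integral (cbox x (x + h *\<^sub>R One)) f /\<^sub>R h ^ DIM(real) - f x) < e"
    using integrable_ccontinuous_explicit by blast
  have "((\<lambda>h. (F (t + h) - F t) / h) \<longlongrightarrow> f t) (at_right 0)" if tN: "t \<notin> N" for t
    unfolding tendsto_iff eventually_at_right_field
  proof (intro allI impI)
    fix e :: real assume "0 < e"
    then obtain d where d: "d > 0" "\<And>h. 0 < h \<Longrightarrow> h < d \<Longrightarrow>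
        norm (integral (cbox t (t + h *\<^sub>R One)) f /\<^sub>R h ^ DIM(real) - f t) < e"
      using N'[OF tN] by blast
    show "\<exists>b>0. \<forall>y>0. y < b \<longrightarrow> dist ((F (t + y) - F t) / y) (f t) < e"
    proof (intro exI[of _ d] conjI allI impI d(1))
      fix h assume h: "0 < h" "h < d"
      have "integral {t..t + h} f = F (t + h) - F t"
        using F[of t "t + h"] h by (intro integral_unique) auto
      then show "dist ((F (t + h) - F t) / h) (f t) < e"
        using d(2)[OF h] by (simp add: dist_norm divide_inverse mult.commute)
    qed
  qed
  then show ?thesis using that N by blast
qed

text \<open>
The left derivative is the right derivative of the reflected function \<open>t \<mapsto> - F (- t)\<close>.
\<close>

lemma indefinite_integral_derivative_ae:
  fixes F f :: "real \<Rightarrow> real"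
  assumes F: "\<And>a b. a \<le> b \<Longrightarrow> (f has_integral (F b - F a)) {a..b}"
  obtains N where "negligible N" "\<And>t. t \<notin> N \<Longrightarrow> (F has_vector_derivative f t) (at t)"
proof -
  obtain N where N: "negligible N"
    "\<And>t. t \<notin> N \<Longrightarrow> ((\<lambda>h. (F (t + h) - F t) / h) \<longlongrightarrow> f t) (at_right 0)"
    using indefinite_integral_right_derivative_ae[OF F] by blast
  have "((\<lambda>t. f (- t)) has_integral (- F (- b) - - F (- a))) {a..b}" if "a \<le> b" for a b
    using has_integral_reflect_real[of f "F (-a) - F (-b)" "-a" "-b"] F[of "-b" "-a"] that by simp
  then obtain N' where N': "negligible N'"
    "\<And>t. t \<notin> N' \<Longrightarrow> ((\<lambda>h. (- F (- (t + h)) - - F (- t)) / h) \<longlongrightarrow> f (- t)) (at_right 0)"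
    using indefinite_integral_right_derivative_ae[of "\<lambda>t. f (- t)" "\<lambda>t. - F (- t)"] by blast
  have "negligible (N \<union> uminus ` N')"
    using N(1) N'(1) negligible_differentiable_image_negligible[of N' "uminus :: real \<Rightarrow> real"]
    by (auto intro!: negligible_Un derivative_intros)
  moreover have "(F has_vector_derivative f t) (at t)" if t: "t \<notin> N \<union> uminus ` N'" for t
  proof -
    have "- t \<notin> N'" using t by force
    then have "((\<lambda>h. (F t - F (t - h)) / h) \<longlongrightarrow> f t) (at_right 0)"
      using N'(2)[of "-t"] by (simp add: algebra_simps)
    then have "((\<lambda>h. (F t - F (t + h)) / (- h)) \<longlongrightarrow> f t) (at_left 0)"
      using filterlim_at_left_to_right[of "\<lambda>h. (F t - F (t + h)) / (- h)" "nhds (f t)" 0] by simp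
    moreover have "(F t - F (t + h)) / (- h) = (F (t + h) - F t) / h" for h
      by (cases "h = 0") (auto simp: field_simps)
    ultimately have "((\<lambda>h. (F (t + h) - F t) / h) \<longlongrightarrow> f t) (at 0)"
      using N(2)[of t] t by (auto simp: filterlim_at_split)
    then show ?thesis
      by (simp add: has_vector_derivative_iff_quotient divide_inverse mult.commute)
  qed
  ultimately show ?thesis using that by blast
qed

lemma emeasure_Ioc_tendsto_UNIV:
  assumes "sets M = sets borel"
  shows "(\<lambda>n. emeasure M {- real n<..real n}) \<longlonglongrightarrow> emeasure M UNIV"
proof -
  have "range (\<lambda>n. {- real n<..real n}) \<subseteq> sets M" "incseq (\<lambda>n. {- real n<..real n})"
    by (auto simp: incseq_def assms)
  from Lim_emeasure_incseq[OF this] show ?thesis by (simp only: UN_Ioc_eq_UNIV)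
qed

text \<open>
If a measure is split on half-open intervals into two Stieltjes measures, it is split on all Borel
sets, since these intervals form an intersection-stable generator. The purpose is the consequence
that each of the two Stieltjes measures is dominated by \<open>\<mu>\<close>; domination itself could not be carried
through complements of sets, whereas equality can.
\<close>

lemma interval_measure_add:
  assumes \<mu>: "finite_borel_measure \<mu>"
    and F: "\<And>a b. a \<le> b \<Longrightarrow> F a \<le> F b" "\<And>a. continuous (at_right a) F"
    and H: "\<And>a b. a \<le> b \<Longrightarrow> H a \<le> H b" "\<And>a. continuous (at_right a) H"
    and fin: "emeasure (interval_measure F) UNIV < \<infinity>" "emeasure (interval_measure H) UNIV < \<infinity>"
    and eq: "\<And>a b. a \<le> b \<Longrightarrow> (F b - F a) + (H b - H a) = measure \<mu> {a<..b}"
    and A: "A \<in> sets borel"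
  shows "emeasure (interval_measure F) A + emeasure (interval_measure H) A = emeasure \<mu> A"
proof -
  interpret finite_borel_measure \<mu> by fact
  let ?F = "interval_measure F" and ?H = "interval_measure H"
  let ?G = "range (\<lambda>(a, b). {a <.. b::real})"
  have Ioc: "emeasure ?F {a<..b} + emeasure ?H {a<..b} = emeasure \<mu> {a<..b}" for a b
  proof (cases "a \<le> b")
    case True
    then have "emeasure ?F {a<..b} + emeasure ?H {a<..b} = ennreal ((F b - F a) + (H b - H a))"
      using F(1)[OF True] H(1)[OF True]
      by (simp add: emeasure_interval_measure_Ioc F H del: ennreal_plus add: ennreal_plus[symmetric])
    then show ?thesis using eq[OF True] by (simp add: emeasure_eq_measure)
  qed simp
  have U: "emeasure ?F UNIV + emeasure ?H UNIV = emeasure \<mu> UNIV"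
  proof -
    have "(\<lambda>n. emeasure ?F {- real n<..real n} + emeasure ?H {- real n<..real n})
        \<longlonglongrightarrow> emeasure ?F UNIV + emeasure ?H UNIV"
      by (intro tendsto_add emeasure_Ioc_tendsto_UNIV) auto
    then show ?thesis using emeasure_Ioc_tendsto_UNIV[OF M_is_borel] unfolding Ioc using LIMSEQ_unique by blast
  qed
  have "Int_stable ?G" "?G \<subseteq> Pow UNIV"
    by (auto simp: Int_stable_def)
  moreover have "A \<in> sigma_sets UNIV ?G"
    using A by (simp add: borel_sigma_sets_Ioc)
  ultimately show ?thesis
  proof (induction rule: sigma_sets_induct_disjoint)
    case (basic B) then show ?case using Ioc by auto
  next
    case (compl B)
    then have B: "B \<in> sets borel" by (simp add: borel_sigma_sets_Ioc)
    have fB: "emeasure ?F B < \<infinity>" "emeasure ?H B < \<infinity>"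
      using fin emeasure_mono[of B UNIV ?F] emeasure_mono[of B UNIV ?H] by (auto intro: le_less_trans)
    have "emeasure ?F (UNIV - B) = emeasure ?F UNIV - emeasure ?F B"
      "emeasure ?H (UNIV - B) = emeasure ?H UNIV - emeasure ?H B"
      "emeasure \<mu> (UNIV - B) = emeasure \<mu> UNIV - emeasure \<mu> B"
      using B fB emeasure_compl[of B ?F] emeasure_compl[of B ?H] emeasure_compl[of B \<mu>]
      by (auto simp: borel_UNIV sets_M)
    moreover have "(a - b) + (c - d) = (a + c) - (b + d)" if le: "b \<le> a" "d \<le> c" and f: "b < \<infinity>" "d < \<infinity>" for a b c d :: ennreal
    proof -
      obtain x y where "a = b + x" "c = d + y" using le by (auto simp: le_iff_add)
      moreover have "b + x + (d + y) = (b + d) + (x + y)" by (simp add: ac_simps)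
      moreover have "b + d \<noteq> \<infinity>" using f by (auto simp: less_top)
      ultimately show ?thesis using f by (metis ennreal_add_diff_cancel_left infinity_ennreal_def less_irrefl)
    qed
    moreover have "emeasure ?F B \<le> emeasure ?F UNIV" "emeasure ?H B \<le> emeasure ?H UNIV"
      by (auto intro!: emeasure_mono)
    ultimately show ?case using fB U compl by simp
  next
    case (union B)
    then have B: "range B \<subseteq> sets borel" by (auto simp: borel_sigma_sets_Ioc)
    have "(\<Sum>i. emeasure ?F (B i)) + (\<Sum>i. emeasure ?H (B i)) = (\<Sum>i. emeasure ?F (B i) + emeasure ?H (B i))"
      by (rule suminf_add) auto
    also have "\<dots> = (\<Sum>i. emeasure \<mu> (B i))" using union by simp
    finally show ?case
      using suminf_emeasure[of B ?F] suminf_emeasure[of B ?H] suminf_emeasure[of B \<mu>] B union(1) M_is_borel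
      by simp
  qed auto
qed

lemma (in finite_borel_measure) cdf_diff_eq_le:
  "a \<le> b \<Longrightarrow> cdf M b - cdf M a = measure M {a<..b}"
  using cdf_diff_eq[of a b] by (cases "a = b") auto

text \<open>
The Stieltjes measure of \<open>F\<close> and that of the remainder \<open>cdf \<mu> - F\<close> add up to \<open>\<mu>\<close>, so the former
inherits absolute continuity from \<open>\<mu>\<close>. Its Radon--Nikodym density \<open>f\<close> exhibits \<open>F\<close> as an indefinite
integral, to which Lebesgue's differentiation theorem applies.
\<close>

lemma dominated_mono_differentiable_ae:
  fixes F :: "real \<Rightarrow> real"
  assumes \<mu>: "finite_borel_measure \<mu>" and ac: "absolutely_continuous lborel \<mu>"
    and F: "\<And>a b. a \<le> b \<Longrightarrow> F a \<le> F b" "\<And>a b. a \<le> b \<Longrightarrow> F b - F a \<le> measure \<mu> {a<..b}"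
  obtains N where "negligible N" "\<And>t. t \<notin> N \<Longrightarrow> \<exists>D. (F has_vector_derivative D) (at t)"
proof -
  interpret finite_borel_measure \<mu> by fact
  define H where "H = (\<lambda>t. cdf \<mu> t - F t)"
  note cdf = cdf_diff_eq_le
  have H: "H a \<le> H b" if "a \<le> b" for a b
    using F(2)[OF that] cdf[OF that] by (simp add: H_def)
  have Frc: "continuous (at_right a) F" for a
  proof -
    have "((\<lambda>t. F t - F a) \<longlongrightarrow> 0) (at_right a)"
    proof (rule Lim_null_comparison)
      show "\<forall>\<^sub>F t in at_right a. norm (F t - F a) \<le> cdf \<mu> t - cdf \<mu> a"
        using F cdf by (auto simp: eventually_at_filter intro!: always_eventually)
      show "((\<lambda>t. cdf \<mu> t - cdf \<mu> a) \<longlongrightarrow> 0) (at_right a)"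
        using cdf_is_right_cont[of a] by (simp add: continuous_within LIM_zero)
    qed
    then show ?thesis by (simp add: continuous_within LIM_zero_iff)
  qed
  have Hrc: "continuous (at_right a) H" for a
    unfolding H_def by (intro continuous_intros cdf_is_right_cont Frc)
  have fin: "emeasure (interval_measure E) UNIV < \<infinity>"
    if E: "\<And>a b. a \<le> b \<Longrightarrow> E a \<le> E b" "\<And>a. continuous (at_right a) E"
      "\<And>a b. a \<le> b \<Longrightarrow> E b - E a \<le> measure \<mu> {a<..b}" for E
  proof -
    have "(\<lambda>n. emeasure (interval_measure E) {- real n<..real n}) \<longlonglongrightarrow> emeasure (interval_measure E) UNIV"
      by (rule emeasure_Ioc_tendsto_UNIV) simp
    moreover have "emeasure (interval_measure E) {- real n<..real n} \<le> ennreal (measure \<mu> (space \<mu>))" for n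
      using order_trans[OF E(3)[of "- real n" "real n"] bounded_measure]
      by (simp add: emeasure_interval_measure_Ioc E ennreal_leI)
    ultimately have "emeasure (interval_measure E) UNIV \<le> ennreal (measure \<mu> (space \<mu>))"
      by (intro LIMSEQ_le_const2) auto
    then show ?thesis by (simp add: le_less_trans)
  qed
  have finF: "emeasure (interval_measure F) UNIV < \<infinity>" by (rule fin[OF F(1) Frc F(2)])
  have finH: "emeasure (interval_measure H) UNIV < \<infinity>"
  proof (rule fin[OF H Hrc])
    show "H b - H a \<le> measure \<mu> {a<..b}" if "a \<le> b" for a b
      using F(1)[OF that] cdf[OF that] by (simp add: H_def)
  qed
  have add: "emeasure (interval_measure F) A + emeasure (interval_measure H) A = emeasure \<mu> A"
    if "A \<in> sets borel" for A
    by (rule interval_measure_add[OF \<mu> F(1) Frc H Hrc finF finH _ that]) (simp_all add: H_def cdf)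
  have "absolutely_continuous lborel (interval_measure F)"
    unfolding absolutely_continuous_def
  proof
    fix A :: "real set" assume A: "A \<in> null_sets lborel"
    then have "A \<in> null_sets \<mu>" using ac by (auto simp: absolutely_continuous_def)
    with A add[of A] show "A \<in> null_sets (interval_measure F)" by (auto simp: null_sets_def)
  qed
  then obtain g :: "real \<Rightarrow> ennreal" where g: "g \<in> borel_measurable lborel" "density lborel g = interval_measure F"
    using sigma_finite_measure.Radon_Nikodym[OF sigma_finite_lborel, of "interval_measure F"] by auto
  define f where "f = (\<lambda>t. enn2real (g t))"
  have gfin: "AE t in lborel. g t < \<infinity>"
  proof -
    have "(\<integral>\<^sup>+t. g t \<partial>lborel) = emeasure (interval_measure F) UNIV"
      using g by (simp add: g(2)[symmetric] emeasure_density)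
    then have "(\<integral>\<^sup>+t. g t \<partial>lborel) \<noteq> \<infinity>" using finF by simp
    from nn_integral_noteq_infinite[OF g(1) this] show ?thesis by (auto simp: top.not_eq_extremum)
  qed
  have "(f has_integral (F b - F a)) {a..b}" if ab: "a \<le> b" for a b
  proof -
    have "(\<integral>\<^sup>+t. ennreal (f t * indicator {a<..b} t) \<partial>lborel) = (\<integral>\<^sup>+t. g t * indicator {a<..b} t \<partial>lborel)"
      using gfin by (intro nn_integral_cong_AE) (auto simp: f_def indicator_def)
    also have "\<dots> = emeasure (interval_measure F) {a<..b}"
      using g by (simp add: g(2)[symmetric] emeasure_density)
    also have "\<dots> = ennreal (F b - F a)"
      using ab by (simp add: emeasure_interval_measure_Ioc F(1) Frc)
    finally have "((\<lambda>t. f t * indicator {a<..b} t) has_integral (F b - F a)) UNIV"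
      using F(1)[OF ab] g(1) by (intro nn_integral_has_integral) (auto simp: f_def)
    moreover have "(\<lambda>t. f t * indicator {a<..b} t) = (\<lambda>t. if t \<in> {a<..b} then f t else 0)"
      by (auto simp: indicator_def)
    ultimately have "(f has_integral (F b - F a)) {a<..b}"
      by (simp only: has_integral_restrict_UNIV)
    then show ?thesis
      by (rule has_integral_spike_set_eq[THEN iffD1, rotated -1]) (auto intro: negligible_subset[of "{a}"])
  qed
  then obtain N where "negligible N" "\<And>t. t \<notin> N \<Longrightarrow> (F has_vector_derivative f t) (at t)"
    using indefinite_integral_derivative_ae by blast
  then show ?thesis using that by blast
qed

text \<open>
A real function \<open>p\<close> whose increments are dominated by \<open>\<mu>\<close> becomes increasing after adding \<open>cdf \<mu>\<close>, and
half of the sum is again dominated by \<open>\<mu>\<close>. This is applied to the real and the imaginary part.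
\<close>

lemma dominated_differentiable_ae:
  fixes x :: "real \<Rightarrow> complex"
  assumes \<mu>: "finite_borel_measure \<mu>" and ac: "absolutely_continuous lborel \<mu>"
    and x: "\<And>a b. a \<le> b \<Longrightarrow> cmod (x b - x a) \<le> measure \<mu> {a<..b}"
  obtains N where "negligible N" "\<And>t. t \<notin> N \<Longrightarrow> \<exists>D. (x has_vector_derivative D) (at t)"
proof -
  interpret finite_borel_measure \<mu> by fact
  note cdf = cdf_diff_eq_le
  have *: "\<exists>N. negligible N \<and> (\<forall>t. t \<notin> N \<longrightarrow> (\<exists>D. (p has_vector_derivative D) (at t)))"
    if p: "\<And>a b. a \<le> b \<Longrightarrow> \<bar>p b - p a\<bar> \<le> measure \<mu> {a<..b}" for p :: "real \<Rightarrow> real"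
  proof -
    obtain N1 where N1: "negligible N1" "\<And>t. t \<notin> N1 \<Longrightarrow> \<exists>D. (cdf \<mu> has_vector_derivative D) (at t)"
      by (rule dominated_mono_differentiable_ae[OF \<mu> ac, of "cdf \<mu>"]) (auto simp: cdf_nondecreasing cdf)
    obtain N2 where N2: "negligible N2"
      "\<And>t. t \<notin> N2 \<Longrightarrow> \<exists>D. ((\<lambda>t. (p t + cdf \<mu> t) / 2) has_vector_derivative D) (at t)"
    proof (rule dominated_mono_differentiable_ae[OF \<mu> ac, of "\<lambda>t. (p t + cdf \<mu> t) / 2"])
      fix a b :: real assume ab: "a \<le> b"
      have "\<bar>p b - p a\<bar> \<le> cdf \<mu> b - cdf \<mu> a" using p[OF ab] cdf[OF ab] by simp
      then show "(p a + cdf \<mu> a) / 2 \<le> (p b + cdf \<mu> b) / 2"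
        and "(p b + cdf \<mu> b) / 2 - (p a + cdf \<mu> a) / 2 \<le> measure \<mu> {a<..b}"
        using cdf[OF ab] by (auto simp: abs_le_iff field_simps)
    qed auto
    have "\<exists>D. (p has_vector_derivative D) (at t)" if tN: "t \<notin> N1 \<union> N2" for t
    proof -
      obtain D1 D2 where "(cdf \<mu> has_vector_derivative D1) (at t)"
          "((\<lambda>t. (p t + cdf \<mu> t) / 2) has_vector_derivative D2) (at t)"
        using N1(2)[of t] N2(2)[of t] tN by blast
      then have "((\<lambda>t. 2 *\<^sub>R ((p t + cdf \<mu> t) / 2) - cdf \<mu> t) has_vector_derivative (2 *\<^sub>R D2 - D1)) (at t)"
        by (intro has_vector_derivative_diff bounded_linear.has_vector_derivative[OF bounded_linear_scaleR_right])
      moreover have "(\<lambda>t. 2 *\<^sub>R ((p t + cdf \<mu> t) / 2) - cdf \<mu> t) = p"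
        by (auto simp: fun_eq_iff field_simps)
      ultimately show ?thesis by auto
    qed
    then show ?thesis using N1(1) N2(1) by (intro exI[of _ "N1 \<union> N2"]) (auto intro: negligible_Un)
  qed
  have "\<bar>Re (x b) - Re (x a)\<bar> \<le> measure \<mu> {a<..b}" "\<bar>Im (x b) - Im (x a)\<bar> \<le> measure \<mu> {a<..b}" if "a \<le> b" for a b
    using x[OF that] abs_Re_le_cmod[of "x b - x a"] abs_Im_le_cmod[of "x b - x a"] by auto
  then obtain N1 N2 where N: "negligible N1" "\<And>t. t \<notin> N1 \<Longrightarrow> \<exists>D. ((\<lambda>t. Re (x t)) has_vector_derivative D) (at t)"
      "negligible N2" "\<And>t. t \<notin> N2 \<Longrightarrow> \<exists>D. ((\<lambda>t. Im (x t)) has_vector_derivative D) (at t)"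
    using *[of "\<lambda>t. Re (x t)"] *[of "\<lambda>t. Im (x t)"] by blast
  have "\<exists>D. (x has_vector_derivative D) (at t)" if t: "t \<notin> N1 \<union> N2" for t
  proof -
    obtain D1 D2 where "((\<lambda>t. Re (x t)) has_vector_derivative D1) (at t)" "((\<lambda>t. Im (x t)) has_vector_derivative D2) (at t)"
      using N t by blast
    then have "(x has_vector_derivative Complex D1 D2) (at t)"
      by (simp add: has_vector_derivative_complex_iff has_real_derivative_iff_has_vector_derivative)
    then show ?thesis by blast
  qed
  then show ?thesis using that[of "N1 \<union> N2"] N by (auto intro: negligible_Un)
qed

section \<open>Measures dominating the increments of an evolution family\<close>
text \<open>
On a bounded interval \<open>L\<^sup>d\<close> is contained in \<open>L\<^sup>1\<close>, as \<open>\<bar>y\<bar> \<le> 1 + \<bar>y\<bar>\<^sup>p\<close> for \<open>p \<ge> 1\<close>.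
\<close>

lemma Ld_on_imp_integrable:
  assumes d: "1 \<le> d" and k: "Ld_on d T k"
  shows "integrable (lebesgue_on {0..T}) k"
proof (cases "d = \<infinity>")
  case True
  then obtain C where C: "AE \<xi> in lebesgue_on {0..T}. \<bar>k \<xi>\<bar> \<le> C"
    using k by (auto simp: Ld_on_def)
  have "integrable (lebesgue_on {0..T}) (\<lambda>_. C)" by simp
  then show ?thesis
    by (rule Bochner_Integration.integrable_bound) (use k C in \<open>auto simp: Ld_on_def\<close>)
next
  case False
  define p where "p = enn2real d"
  have p: "1 \<le> p" using d False unfolding p_def by (metis enn2real_1 enn2real_mono infinity_ennreal_def less_top)
  have le: "\<bar>y\<bar> \<le> 1 + \<bar>y\<bar> powr p" for y :: real
  proof (cases "\<bar>y\<bar> \<le> 1")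
    case True then show ?thesis by (simp add: add_increasing2)
  next
    case False
    then have "\<bar>y\<bar> powr 1 \<le> \<bar>y\<bar> powr p" using p by (intro powr_mono) auto
    then show ?thesis using False by simp
  qed
  have "integrable (lebesgue_on {0..T}) (\<lambda>\<xi>. 1 + \<bar>k \<xi>\<bar> powr p)"
    using k False by (intro Bochner_Integration.integrable_add) (auto simp: Ld_on_def p_def)
  then show ?thesis
    by (rule Bochner_Integration.integrable_bound) (use k le in \<open>auto simp: Ld_on_def\<close>)
qed

text \<open>
Replaces a Lebesgue integrable bound by a Borel measure, the form in which the differentiation
results above take it. The density has to be changed on a null set to become Borel measurable.
\<close>

lemma lebesgue_integral_measure:
  fixes k :: "real \<Rightarrow> real"
  assumes k: "integrable (lebesgue_on {a..b}) k" and nonneg: "\<And>\<xi>. \<xi> \<in> {a..b} \<Longrightarrow> 0 \<le> k \<xi>"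
  obtains \<mu> where "finite_borel_measure \<mu>" "absolutely_continuous lborel \<mu>"
    "\<And>u t. a \<le> u \<Longrightarrow> u \<le> t \<Longrightarrow> t \<le> b \<Longrightarrow> measure \<mu> {u<..t} = (LINT \<xi>|lebesgue_on {u..t}. k \<xi>)"
proof -
  define k0 where "k0 = (\<lambda>\<xi>. indicator {a..b} \<xi> * k \<xi>)"
  have k0: "integrable lebesgue k0"
    using k by (simp add: integrable_restrict_space k0_def)
  then obtain k1 where k1: "k1 \<in> borel_measurable lborel" "AE \<xi> in lborel. k0 \<xi> = k1 \<xi>"
    using completion_ex_borel_measurable_real[of k0 lborel] by auto
  define k2 where "k2 = (\<lambda>\<xi>. max 0 (k1 \<xi>))"
  have k2m [measurable]: "k2 \<in> borel_measurable lborel" using k1(1) unfolding k2_def by measurable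
  have k0_nonneg: "0 \<le> k0 \<xi>" for \<xi> using nonneg by (simp add: k0_def indicator_def)
  have "k0 \<xi> = k2 \<xi>" if "k0 \<xi> = k1 \<xi>" for \<xi>
    using k0_nonneg[of \<xi>] that by (simp add: k2_def)
  then have eq: "AE \<xi> in lborel. k0 \<xi> = k2 \<xi>"
    using k1(2) by (auto elim: eventually_mono)
  then have eq': "AE \<xi> in lebesgue. k0 \<xi> = k2 \<xi>" by (rule AE_completion)
  have "integrable lebesgue k2"
    using k0 integrable_cong_AE[OF _ _ eq'] borel_measurable_integrable[OF k0] measurable_completion[OF k2m] by blast
  then have k2: "integrable lborel k2" using integrable_completion[OF k2m] by simp
  have k2_nonneg: "0 \<le> k2 \<xi>" for \<xi> by (simp add: k2_def)
  define \<mu> where "\<mu> = density lborel (\<lambda>\<xi>. ennreal (k2 \<xi>))"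
  have em: "emeasure \<mu> A = ennreal (\<integral>\<xi>. k2 \<xi> * indicator A \<xi> \<partial>lborel)" if [measurable]: "A \<in> sets borel" for A
  proof -
    have "emeasure \<mu> A = (\<integral>\<^sup>+\<xi>. ennreal (k2 \<xi> * indicator A \<xi>) \<partial>lborel)"
      unfolding \<mu>_def by (subst emeasure_density) (auto simp: ennreal_mult' ennreal_indicator k2_nonneg intro!: nn_integral_cong)
    also have "\<dots> = ennreal (\<integral>\<xi>. k2 \<xi> * indicator A \<xi> \<partial>lborel)"
      using k2 by (intro nn_integral_eq_integral integrable_real_mult_indicator) (auto simp: k2_nonneg)
    finally show ?thesis .
  qed
  have "finite_borel_measure \<mu>"
  proof (intro finite_borel_measure.intro finite_measureI finite_borel_measure_axioms.intro)
    show "emeasure \<mu> (space \<mu>) \<noteq> \<infinity>" using em[of UNIV] by (simp add: \<mu>_def)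
  qed (simp add: \<mu>_def)
  moreover have "absolutely_continuous lborel \<mu>"
    unfolding \<mu>_def by (intro absolutely_continuousI_density) measurable
  moreover have "measure \<mu> {u<..t} = (LINT \<xi>|lebesgue_on {u..t}. k \<xi>)"
    if ut: "a \<le> u" "u \<le> t" "t \<le> b" for u t
  proof -
    have "(LINT \<xi>|lebesgue_on {u..t}. k \<xi>) = (LINT \<xi>|lebesgue. indicator {u..t} \<xi> * k \<xi>)"
      by (simp add: integral_restrict_space)
    also have "\<dots> = (LINT \<xi>|lebesgue. indicator {u..t} \<xi> * k0 \<xi>)"
      using ut by (intro Bochner_Integration.integral_cong) (auto simp: k0_def indicator_def)
    also have "\<dots> = (LINT \<xi>|lebesgue. k2 \<xi> * indicator {u<..t} \<xi>)"
    proof (rule integral_cong_AE)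
      show "(\<lambda>\<xi>. indicator {u..t} \<xi> * k0 \<xi>) \<in> borel_measurable lebesgue"
        using borel_measurable_integrable[OF k0] by (intro borel_measurable_times borel_measurable_indicator) auto
      show "(\<lambda>\<xi>. k2 \<xi> * indicator {u<..t} \<xi>) \<in> borel_measurable lebesgue"
        using measurable_completion[OF k2m] by (intro borel_measurable_times borel_measurable_indicator) auto
      have "AE \<xi> in lebesgue. \<xi> \<noteq> u" by (rule AE_completion[OF AE_lborel_singleton])
      then show "AE \<xi> in lebesgue. indicator {u..t} \<xi> * k0 \<xi> = k2 \<xi> * indicator {u<..t} \<xi>"
        using eq' by eventually_elim (auto simp: indicator_def)
    qed
    also have "\<dots> = (LINT \<xi>|lborel. k2 \<xi> * indicator {u<..t} \<xi>)"
      by (rule integral_completion) measurable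
    also have "\<dots> = measure \<mu> {u<..t}"
      unfolding measure_def by (subst em) (auto simp: k2_nonneg intro!: integral_nonneg)
    finally show ?thesis by simp
  qed
  ultimately show ?thesis using that by blast
qed

text \<open>
The measure depends on \<open>z\<close> and \<open>T\<close> but not on the starting time \<open>s\<close>. This uniformity matters:
with \<open>s = u\<close> it controls the displacement of \<open>z\<close> under \<open>\<phi> u t\<close>.
\<close>

lemma evolution_family_dominating_measure:
  assumes d: "1 \<le> d" and \<phi>: "evolution_family d \<phi>" and z: "z \<in> unit_disc" and T: "0 < T"
  obtains \<mu> where "finite_borel_measure \<mu>" "absolutely_continuous lborel \<mu>"
    "\<And>s u t. 0 \<le> s \<Longrightarrow> s \<le> u \<Longrightarrow> u \<le> t \<Longrightarrow> t \<le> T \<Longrightarrow> cmod (\<phi> s t z - \<phi> s u z) \<le> measure \<mu> {u<..t}"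
proof -
  obtain k where k: "Ld_on d T k" "\<forall>\<xi>\<in>{0..T}. 0 \<le> k \<xi>"
    and le: "\<And>s u t. 0 \<le> s \<Longrightarrow> s \<le> u \<Longrightarrow> u \<le> t \<Longrightarrow> t \<le> T \<Longrightarrow>
      cmod (\<phi> s u z - \<phi> s t z) \<le> (LINT \<xi>|lebesgue_on {u..t}. k \<xi>)"
    using \<phi> z T unfolding evolution_family_def by meson
  obtain \<mu> where \<mu>: "finite_borel_measure \<mu>" "absolutely_continuous lborel \<mu>"
    and eq: "\<And>u t. 0 \<le> u \<Longrightarrow> u \<le> t \<Longrightarrow> t \<le> T \<Longrightarrow> measure \<mu> {u<..t} = (LINT \<xi>|lebesgue_on {u..t}. k \<xi>)"
    using lebesgue_integral_measure[OF Ld_on_imp_integrable[OF d k(1)]] k(2) by blast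
  show ?thesis
  proof (rule that[OF \<mu>])
    show "cmod (\<phi> s t z - \<phi> s u z) \<le> measure \<mu> {u<..t}" if "0 \<le> s" "s \<le> u" "u \<le> t" "t \<le> T" for s u t
      using le[OF that] eq[of u t] that by (simp add: norm_minus_commute)
  qed
qed

section \<open>Time derivatives of evolution families\<close>
lemma has_vector_derivative_iff_complex_quotient:
  "(x has_vector_derivative D) (at t) \<longleftrightarrow>
    ((\<lambda>h. (x (t + h) - x t) / complex_of_real h) \<longlongrightarrow> D) (at 0)"
  by (simp add: has_vector_derivative_iff_quotient scaleR_conv_of_real divide_inverse mult.commute)

context
  fixes d :: ennreal and \<phi> :: "real \<Rightarrow> real \<Rightarrow> complex \<Rightarrow> complex"
  assumes d: "1 \<le> d" and \<phi>: "evolution_family d \<phi>"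
begin

text \<open>
Differentiability of a single orbit; the null set still depends on \<open>z\<close>. The orbit is frozen outside
\<open>[s, T]\<close> to obtain a function on the whole line whose increments are dominated.
\<close>

lemma orbit_differentiable_ae:
  assumes z: "z \<in> unit_disc" and s: "0 \<le> s"
  obtains N where "negligible N"
    "\<And>t. s < t \<Longrightarrow> t \<notin> N \<Longrightarrow> \<exists>D. ((\<lambda>\<tau>. \<phi> s \<tau> z) has_vector_derivative D) (at t)"
proof -
  have "\<exists>N. negligible N \<and> (\<forall>t. s < t \<and> t < T \<and> t \<notin> N \<longrightarrow>
      (\<exists>D. ((\<lambda>\<tau>. \<phi> s \<tau> z) has_vector_derivative D) (at t)))" if T: "s < T" for T
  proof -
    define c where "c = (\<lambda>\<tau>. max s (min \<tau> T))"
    have T0: "0 < T" using s T by simp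
    obtain \<mu> where \<mu>: "finite_borel_measure \<mu>" "absolutely_continuous lborel \<mu>"
      and le: "\<And>s u t. 0 \<le> s \<Longrightarrow> s \<le> u \<Longrightarrow> u \<le> t \<Longrightarrow> t \<le> T \<Longrightarrow> cmod (\<phi> s t z - \<phi> s u z) \<le> measure \<mu> {u<..t}"
      using evolution_family_dominating_measure[OF d \<phi> z T0] by blast
    interpret finite_borel_measure \<mu> by fact
    have dom: "cmod (\<phi> s (c b) z - \<phi> s (c a) z) \<le> measure \<mu> {a<..b}" if "a \<le> b" for a b
    proof -
      have "cmod (\<phi> s (c b) z - \<phi> s (c a) z) \<le> measure \<mu> {c a<..c b}"
        using that s T by (intro le) (auto simp: c_def)
      also have "\<dots> \<le> measure \<mu> {a<..b}"
        by (rule finite_measure_mono) (auto simp: c_def M_is_borel)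
      finally show ?thesis .
    qed
    obtain N where N: "negligible N"
      "\<And>t. t \<notin> N \<Longrightarrow> \<exists>D. ((\<lambda>\<tau>. \<phi> s (c \<tau>) z) has_vector_derivative D) (at t)"
      using dominated_differentiable_ae[OF \<mu>, of "\<lambda>\<tau>. \<phi> s (c \<tau>) z"] dom by blast
    have "\<exists>D. ((\<lambda>\<tau>. \<phi> s \<tau> z) has_vector_derivative D) (at t)" if t: "s < t" "t < T" "t \<notin> N" for t
    proof -
      obtain D where "((\<lambda>\<tau>. \<phi> s (c \<tau>) z) has_vector_derivative D) (at t)" using N(2) t(3) by blast
      then have "((\<lambda>\<tau>. \<phi> s \<tau> z) has_vector_derivative D) (at t)"
        by (rule has_vector_derivative_transform_within_open[of _ _ _ "{s<..<T}"])
           (use t in \<open>auto simp: c_def\<close>)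
      then show ?thesis by blast
    qed
    then show ?thesis using N(1) by blast
  qed
  then have "\<exists>N. negligible N \<and> (\<forall>t. s < t \<and> t < s + real (Suc n) \<and> t \<notin> N \<longrightarrow>
      (\<exists>D. ((\<lambda>\<tau>. \<phi> s \<tau> z) has_vector_derivative D) (at t)))" for n
    by simp
  then obtain N where N: "\<And>n. negligible (N n)"
      "\<And>n t. s < t \<Longrightarrow> t < s + real (Suc n) \<Longrightarrow> t \<notin> N n \<Longrightarrow> \<exists>D. ((\<lambda>\<tau>. \<phi> s \<tau> z) has_vector_derivative D) (at t)"
    by metis
  show ?thesis
  proof (rule that[of "\<Union>n. N n"])
    show "\<exists>D. ((\<lambda>\<tau>. \<phi> s \<tau> z) has_vector_derivative D) (at t)" if t: "s < t" "t \<notin> (\<Union>n. N n)" for t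
    proof -
      obtain n where "t - s < real n" using reals_Archimedean2 by blast
      then show ?thesis using N(2)[of t n] t by auto
    qed
  qed (use N(1) in \<open>auto intro: negligible_countable_Union\<close>)
qed

text \<open>
Since \<open>\<phi> u u z = z\<close>, the displacement of \<open>z\<close> under \<open>\<phi> u v\<close> is at most \<open>cdf \<mu> v - cdf \<mu> u\<close>, and this
is \<open>O(v - u)\<close> around every point \<open>t\<close> at which \<open>cdf \<mu>\<close> is differentiable. The time
\<open>t\<close> may be either end of \<open>[u, v]\<close>, because a two-sided derivative at \<open>t\<close> is the goal.
\<close>

lemma displacement_rate_ae:
  assumes z: "z \<in> unit_disc"
  obtains N where "negligible N"
    "\<And>t. 0 < t \<Longrightarrow> t \<notin> N \<Longrightarrow> \<exists>C \<delta>. 0 < \<delta> \<and> (\<forall>u v. 0 \<le> u \<and> t - \<delta> < u \<and> u \<le> t \<and> t \<le> v \<and> v < t + \<delta> \<longrightarrow>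
        cmod (\<phi> u v z - z) \<le> C * (v - u))"
proof -
  let ?P = "\<lambda>t. \<exists>C \<delta>. 0 < \<delta> \<and> (\<forall>u v. 0 \<le> u \<and> t - \<delta> < u \<and> u \<le> t \<and> t \<le> v \<and> v < t + \<delta> \<longrightarrow>
        cmod (\<phi> u v z - z) \<le> C * (v - u))"
  have "\<exists>N. negligible N \<and> (\<forall>t. 0 < t \<and> t < T \<and> t \<notin> N \<longrightarrow> ?P t)" if T: "0 < T" for T
  proof -
    obtain \<mu> where \<mu>: "finite_borel_measure \<mu>" "absolutely_continuous lborel \<mu>"
      and le: "\<And>s u t. 0 \<le> s \<Longrightarrow> s \<le> u \<Longrightarrow> u \<le> t \<Longrightarrow> t \<le> T \<Longrightarrow> cmod (\<phi> s t z - \<phi> s u z) \<le> measure \<mu> {u<..t}"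
      using evolution_family_dominating_measure[OF d \<phi> z T] by blast
    interpret finite_borel_measure \<mu> by fact
    note cdf = cdf_diff_eq_le
    obtain N where N: "negligible N" "\<And>t. t \<notin> N \<Longrightarrow> \<exists>D. (cdf \<mu> has_vector_derivative D) (at t)"
      by (rule dominated_mono_differentiable_ae[OF \<mu>, of "cdf \<mu>"]) (auto simp: cdf_nondecreasing cdf)
    have "?P t" if t: "0 < t" "t < T" "t \<notin> N" for t
    proof -
      obtain D where "((\<lambda>h. (cdf \<mu> (t + h) - cdf \<mu> t) /\<^sub>R h) \<longlongrightarrow> D) (at 0)"
        using N(2)[OF t(3)] by (auto simp: has_vector_derivative_iff_quotient)
      then have "\<forall>\<^sub>F h in at 0. dist ((cdf \<mu> (t + h) - cdf \<mu> t) /\<^sub>R h) D < 1"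
        by (rule tendstoD) simp
      then obtain \<delta> where \<delta>: "\<delta> > 0" "\<And>h. h \<noteq> 0 \<Longrightarrow> \<bar>h\<bar> < \<delta> \<Longrightarrow> dist ((cdf \<mu> (t + h) - cdf \<mu> t) /\<^sub>R h) D < 1"
        by (auto simp: eventually_at)
      have bnd: "\<bar>cdf \<mu> \<tau> - cdf \<mu> t\<bar> \<le> (\<bar>D\<bar> + 1) * \<bar>\<tau> - t\<bar>" if "\<bar>\<tau> - t\<bar> < \<delta>" for \<tau>
      proof (cases "\<tau> = t")
        case False
        then have "\<bar>(cdf \<mu> \<tau> - cdf \<mu> t) / (\<tau> - t)\<bar> \<le> \<bar>D\<bar> + 1"
          using \<delta>(2)[of "\<tau> - t"] that by (simp add: dist_real_def divide_inverse mult.commute)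
        then show ?thesis using False by (simp add: abs_divide divide_le_eq)
      qed simp
      have "cmod (\<phi> u v z - z) \<le> (\<bar>D\<bar> + 1) * (v - u)"
        if uv: "0 \<le> u \<and> t - min \<delta> (T - t) < u \<and> u \<le> t \<and> t \<le> v \<and> v < t + min \<delta> (T - t)" for u v
      proof -
        have "\<phi> u u z = z" using \<phi> z uv by (simp add: evolution_family_def)
        then have "cmod (\<phi> u v z - z) \<le> measure \<mu> {u<..v}"
          using le[of u u v] uv by auto
        also have "\<dots> = (cdf \<mu> v - cdf \<mu> t) - (cdf \<mu> u - cdf \<mu> t)" using cdf[of u v] uv by simp
        also have "\<dots> \<le> (\<bar>D\<bar> + 1) * \<bar>v - t\<bar> + (\<bar>D\<bar> + 1) * \<bar>u - t\<bar>"
          using bnd[of u] bnd[of v] uv by (auto simp: min_def split: if_splits)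
        also have "\<dots> = (\<bar>D\<bar> + 1) * (v - u)" using uv by (simp add: algebra_simps)
        finally show ?thesis .
      qed
      then show ?thesis using \<delta>(1) t(2) by (intro exI[of _ "\<bar>D\<bar> + 1"] exI[of _ "min \<delta> (T - t)"]) auto
    qed
    then show ?thesis using N(1) by blast
  qed
  then have "\<exists>N. negligible N \<and> (\<forall>t. 0 < t \<and> t < real (Suc n) \<and> t \<notin> N \<longrightarrow> ?P t)" for n
    by simp
  then obtain N where N: "\<And>n. negligible (N n)" "\<And>n t. 0 < t \<Longrightarrow> t < real (Suc n) \<Longrightarrow> t \<notin> N n \<Longrightarrow> ?P t"
    by metis
  show ?thesis
  proof (rule that[of "\<Union>n. N n"])
    show "?P t" if t: "0 < t" "t \<notin> (\<Union>n. N n)" for t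
    proof -
      obtain n where "t < real n" using reals_Archimedean2 by blast
      then have "t < real (Suc n)" by simp
      then show ?thesis using N(2)[of t n] t by blast
    qed
  qed (use N(1) in \<open>auto intro: negligible_countable_Union\<close>)
qed

text \<open>
For \<open>u < v\<close> the two times \<open>t\<close> and \<open>t + h\<close> in increasing order, the increment of the orbit of \<open>z\<close> is the
displacement of the point \<open>\<phi> s u z\<close> under \<open>\<phi> u v\<close>. These points stay in a fixed smaller disc because
\<open>\<phi> s u 0\<close> stays away from the unit circle for \<open>u\<close> near \<open>t\<close>, and there the displacement is
controlled linearly by the displacements of \<open>0\<close> and \<open>1/2\<close>, which are \<open>O(h)\<close> by assumption.
\<close>

lemma difference_quotients_locally_bounded:
  assumes s: "0 \<le> s" "s < t"
    and cont: "isCont (\<lambda>\<tau>. \<phi> s \<tau> 0) t"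
    and rate: "\<And>p. p \<in> {0, 1/2} \<Longrightarrow> \<exists>C \<delta>. 0 < \<delta> \<and>
      (\<forall>u v. 0 \<le> u \<and> t - \<delta> < u \<and> u \<le> t \<and> t \<le> v \<and> v < t + \<delta> \<longrightarrow> cmod (\<phi> u v p - p) \<le> C * (v - u))"
  obtains \<delta> where "0 < \<delta>" "\<delta> \<le> t - s"
    "\<And>r. r < 1 \<Longrightarrow> \<exists>B. \<forall>h. 0 < \<bar>h\<bar> \<and> \<bar>h\<bar> < \<delta> \<longrightarrow>
       (\<forall>z\<in>cball 0 r. cmod ((\<phi> s (t + h) z - \<phi> s t z) / complex_of_real h) \<le> B)"
proof -
  have self: "holomorphic_self_map (\<phi> u v)" if "0 \<le> u" "u \<le> v" for u v
    using \<phi> that by (simp add: evolution_family_def)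
  have in_disc: "cmod (\<phi> u v z) < 1" if "0 \<le> u" "u \<le> v" "cmod z < 1" for u v z
    using self[OF that(1,2)] that(3) by (auto simp: holomorphic_self_map_def image_subset_iff)
  obtain C0 \<delta>0 where 0: "0 < \<delta>0" "\<And>u v. 0 \<le> u \<Longrightarrow> t - \<delta>0 < u \<Longrightarrow> u \<le> t \<Longrightarrow> t \<le> v \<Longrightarrow> v < t + \<delta>0 \<Longrightarrow>
      cmod (\<phi> u v 0 - 0) \<le> C0 * (v - u)"
    using rate[of 0] by blast
  obtain C1 \<delta>1 where 1: "0 < \<delta>1" "\<And>u v. 0 \<le> u \<Longrightarrow> t - \<delta>1 < u \<Longrightarrow> u \<le> t \<Longrightarrow> t \<le> v \<Longrightarrow> v < t + \<delta>1 \<Longrightarrow>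
      cmod (\<phi> u v (1/2) - 1/2) \<le> C1 * (v - u)"
    using rate[of "1/2"] by blast
  \<comment> \<open>Any value strictly between \<open>\<bar>\<phi> s t 0\<bar>\<close> and \<open>1\<close> would do.\<close>
  define a where "a = (1 + cmod (\<phi> s t 0)) / 2"
  have a: "cmod (\<phi> s t 0) < a" "a < 1" using in_disc[of s t 0] s by (auto simp: a_def)
  have "((\<lambda>\<tau>. cmod (\<phi> s \<tau> 0)) \<longlongrightarrow> cmod (\<phi> s t 0)) (at t)"
    using cont by (intro tendsto_norm) (simp add: isCont_def)
  then have "\<forall>\<^sub>F \<tau> in at t. cmod (\<phi> s \<tau> 0) < a" by (rule order_tendstoD) (use a in simp)
  then obtain \<delta>2 where 2: "0 < \<delta>2" "\<And>\<tau>. \<bar>\<tau> - t\<bar> < \<delta>2 \<Longrightarrow> cmod (\<phi> s \<tau> 0) \<le> a"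
    using a(1) by (auto simp: eventually_at dist_real_def) (metis less_imp_le)
  define \<delta> where "\<delta> = Min {\<delta>0, \<delta>1, \<delta>2, t - s}"
  have \<delta>: "0 < \<delta>" "\<delta> \<le> \<delta>0" "\<delta> \<le> \<delta>1" "\<delta> \<le> \<delta>2" "\<delta> \<le> t - s"
    using 0(1) 1(1) 2(1) s by (auto simp: \<delta>_def)
  show ?thesis
  proof (rule that[OF \<delta>(1,5)])
    fix r :: real assume r: "r < 1"
    define \<rho> where "\<rho> = 1 - (1 - a) * ((1 - r) / (1 + r))"
    define B where "B = 14 * ((1 + \<rho>) / (1 - \<rho>)) * (C0 + C1)"
    have "cmod ((\<phi> s (t + h) z - \<phi> s t z) / complex_of_real h) \<le> B"
      if h: "0 < \<bar>h\<bar>" "\<bar>h\<bar> < \<delta>" and z: "z \<in> cball 0 r" for h z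
    proof -
      have z': "cmod z \<le> r" using z by simp
      then have r0: "0 \<le> r" using norm_ge_zero order_trans by blast
      have \<rho>: "\<rho> < 1" using a r r0 by (simp add: \<rho>_def)
      define u v where "u = min t (t + h)" and "v = max t (t + h)"
      have uv: "s \<le> u" "0 \<le> u" "u \<le> t" "t \<le> v" "v - u = \<bar>h\<bar>" "\<bar>u - t\<bar> < \<delta>" "\<bar>v - t\<bar> < \<delta>"
        using h \<delta> s by (auto simp: u_def v_def)
      define w where "w = \<phi> s u z"
      have w: "cmod w \<le> \<rho>"
        unfolding w_def \<rho>_def using uv s \<delta> a z' r 2(2)[of u] by (intro self_map_image_bound self) auto
      have comp: "\<phi> s v z = \<phi> u v w"
        using \<phi> uv s z' r by (auto simp: evolution_family_def w_def)
      have "cmod (\<phi> s (t + h) z - \<phi> s t z) = cmod (\<phi> s v z - \<phi> s u z)"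
        by (auto simp: u_def v_def min_def max_def norm_minus_commute)
      also have "\<dots> = cmod (\<phi> u v w - w)" by (simp add: comp w_def)
      also have "\<dots> \<le> 14 * ((1 + \<rho>) / (1 - \<rho>)) * (cmod (\<phi> u v 0) + cmod (\<phi> u v (1/2) - 1/2))"
        using uv w \<rho> by (intro self_map_displacement_bound self) auto
      also have "\<dots> \<le> 14 * ((1 + \<rho>) / (1 - \<rho>)) * (C0 * \<bar>h\<bar> + C1 * \<bar>h\<bar>)"
      proof (intro mult_left_mono add_mono)
        show "cmod (\<phi> u v 0) \<le> C0 * \<bar>h\<bar>" using 0(2)[of u v] uv \<delta> by simp
        show "cmod (\<phi> u v (1/2) - 1/2) \<le> C1 * \<bar>h\<bar>" using 1(2)[of u v] uv \<delta> by simp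
        have "0 \<le> \<rho>" using w norm_ge_zero order_trans by blast
        then show "0 \<le> 14 * ((1 + \<rho>) / (1 - \<rho>))" using \<rho> by simp
      qed
      also have "\<dots> = B * \<bar>h\<bar>" by (simp add: B_def algebra_simps)
      finally show ?thesis using h by (simp add: norm_divide divide_le_eq)
    qed
    then show "\<exists>B. \<forall>h. 0 < \<bar>h\<bar> \<and> \<bar>h\<bar> < \<delta> \<longrightarrow>
       (\<forall>z\<in>cball 0 r. cmod ((\<phi> s (t + h) z - \<phi> s t z) / complex_of_real h) \<le> B)"
      by blast
  qed
qed

text \<open>
Only countably many exceptional sets are used: those of the orbits of a countable dense set \<open>Q\<close> and
of \<open>0\<close>, and those of the displacement rates of \<open>0\<close> and \<open>1/2\<close>. Off their union the difference
quotients converge on \<open>Q\<close> and are locally bounded, so they converge everywhere to a holomorphic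
function.
\<close>

lemma time_derivative_holomorphic_ae:
  assumes s: "0 \<le> s"
  obtains N where "negligible N"
    "\<And>t. s < t \<Longrightarrow> t \<notin> N \<Longrightarrow> \<exists>f. f holomorphic_on unit_disc \<and>
      (\<forall>z\<in>unit_disc. ((\<lambda>\<tau>. \<phi> s \<tau> z) has_vector_derivative f z) (at t))"
proof -
  obtain Q :: "complex set" where Q: "countable Q" "Q \<subseteq> unit_disc" "unit_disc \<subseteq> closure Q"
    using separable by blast
  have "\<exists>N. negligible N \<and> (\<forall>t>s. t \<notin> N \<longrightarrow> (\<exists>D. ((\<lambda>\<tau>. \<phi> s \<tau> z) has_vector_derivative D) (at t)))"
    if "z \<in> unit_disc" for z
    using orbit_differentiable_ae[OF that s] by blast
  then obtain N where N: "\<And>z. z \<in> unit_disc \<Longrightarrow> negligible (N z)"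
    "\<And>z t. z \<in> unit_disc \<Longrightarrow> s < t \<Longrightarrow> t \<notin> N z \<Longrightarrow> \<exists>D. ((\<lambda>\<tau>. \<phi> s \<tau> z) has_vector_derivative D) (at t)"
    by metis
  obtain N0 where N0: "negligible N0" "\<And>t. 0 < t \<Longrightarrow> t \<notin> N0 \<Longrightarrow> \<exists>C \<delta>. 0 < \<delta> \<and>
      (\<forall>u v. 0 \<le> u \<and> t - \<delta> < u \<and> u \<le> t \<and> t \<le> v \<and> v < t + \<delta> \<longrightarrow> cmod (\<phi> u v 0 - 0) \<le> C * (v - u))"
    by (rule displacement_rate_ae[of 0]) auto
  obtain N1 where N1: "negligible N1" "\<And>t. 0 < t \<Longrightarrow> t \<notin> N1 \<Longrightarrow> \<exists>C \<delta>. 0 < \<delta> \<and>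
      (\<forall>u v. 0 \<le> u \<and> t - \<delta> < u \<and> u \<le> t \<and> t \<le> v \<and> v < t + \<delta> \<longrightarrow> cmod (\<phi> u v (1/2) - 1/2) \<le> C * (v - u))"
    by (rule displacement_rate_ae[of "1/2"]) auto
  let ?N = "(\<Union>z\<in>insert 0 Q. N z) \<union> (N0 \<union> N1)"
  have "negligible (\<Union>z\<in>insert 0 Q. N z)"
    using Q N(1) by (intro negligible_countable_Union) auto
  then have "negligible ?N" using N0(1) N1(1) by (intro negligible_Un)
  moreover have "\<exists>f. f holomorphic_on unit_disc \<and>
      (\<forall>z\<in>unit_disc. ((\<lambda>\<tau>. \<phi> s \<tau> z) has_vector_derivative f z) (at t))" if t: "s < t" "t \<notin> ?N" for t
  proof -
    let ?D = "\<lambda>h z. (\<phi> s (t + h) z - \<phi> s t z) / complex_of_real h"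
    have t0: "0 < t" using s t by simp
    have "isCont (\<lambda>\<tau>. \<phi> s \<tau> 0) t"
      using N(2)[of 0 t] t by (auto intro: has_vector_derivative_continuous)
    then obtain \<delta> where \<delta>: "0 < \<delta>" "\<delta> \<le> t - s"
      and bdd: "\<And>r. r < 1 \<Longrightarrow> \<exists>B. \<forall>h. 0 < \<bar>h\<bar> \<and> \<bar>h\<bar> < \<delta> \<longrightarrow> (\<forall>z\<in>cball 0 r. cmod (?D h z) \<le> B)"
    proof (rule difference_quotients_locally_bounded[OF s t(1)])
      fix p :: complex assume "p \<in> {0, 1/2}"
      then consider "p = 0" | "p = 1/2" by blast
      then show "\<exists>C \<delta>. 0 < \<delta> \<and> (\<forall>u v. 0 \<le> u \<and> t - \<delta> < u \<and> u \<le> t \<and> t \<le> v \<and> v < t + \<delta> \<longrightarrow>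
          cmod (\<phi> u v p - p) \<le> C * (v - u))"
      proof cases
        case 1 show ?thesis unfolding 1 using t(2) by (intro N0(2)[OF t0]) blast
      next
        case 2 show ?thesis unfolding 2 using t(2) by (intro N1(2)[OF t0]) blast
      qed
    qed blast
    obtain f where "f holomorphic_on unit_disc" "\<And>z. z \<in> unit_disc \<Longrightarrow> ((\<lambda>h. ?D h z) \<longlongrightarrow> f z) (at 0)"
    proof (rule vitali_porter_at_0[OF open_ball \<delta>(1), where D = ?D and Q = Q])
      fix h :: real assume h: "0 < \<bar>h\<bar>" "\<bar>h\<bar> < \<delta>"
      then have "holomorphic_self_map (\<phi> s (t + h))" "holomorphic_self_map (\<phi> s t)"
        using \<phi> s t \<delta> by (auto simp: evolution_family_def)
      then show "?D h holomorphic_on unit_disc"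
        using h by (intro holomorphic_intros) (auto simp: holomorphic_self_map_def)
    next
      fix K :: "complex set" assume K: "compact K" "K \<subseteq> unit_disc"
      obtain r where r: "r < 1" "K \<subseteq> cball 0 r"
      proof (cases "K = {}")
        case True then show ?thesis using that[of 0] by simp
      next
        case False
        then obtain k where "k \<in> K" "\<And>z. z \<in> K \<Longrightarrow> cmod z \<le> cmod k"
          using continuous_attains_sup[OF K(1), of cmod] by (auto intro: continuous_intros)
        then have "cmod k < 1" "K \<subseteq> cball 0 (cmod k)" using K(2) by auto
        then show ?thesis by (rule that)
      qed
      then show "\<exists>B. \<forall>h. 0 < \<bar>h\<bar> \<and> \<bar>h\<bar> < \<delta> \<longrightarrow> (\<forall>z\<in>K. cmod (?D h z) \<le> B)"
        using bdd[OF r(1)] by (meson subsetD)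
    next
      fix q assume "q \<in> Q"
      then show "\<exists>l. ((\<lambda>h. ?D h q) \<longlongrightarrow> l) (at 0)"
        using N(2)[of q t] t Q(2) by (auto simp: has_vector_derivative_iff_complex_quotient)
    qed (use Q in auto)
    then show ?thesis by (auto simp: has_vector_derivative_iff_complex_quotient)
  qed
  ultimately show ?thesis using that by blast
qed

end

lemma trajectory_derivative_ae:
  assumes "positive_trajectories G \<phi>" "z \<in> unit_disc" "0 \<le> s"
  obtains N where "negligible N"
    "\<And>t. s < t \<Longrightarrow> t \<notin> N \<Longrightarrow> ((\<lambda>\<tau>. \<phi> s \<tau> z) has_vector_derivative G (\<phi> s t z) t) (at t)"
proof -
  have "AE t in lebesgue_on {s..}. ((\<lambda>\<tau>. \<phi> s \<tau> z) has_vector_derivative G (\<phi> s t z) t) (at t within {s..})"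
    using assms by (auto simp: positive_trajectories_def)
  then have "AE t in lebesgue. t \<in> {s..} \<longrightarrow>
      ((\<lambda>\<tau>. \<phi> s \<tau> z) has_vector_derivative G (\<phi> s t z) t) (at t within {s..})"
    by (subst (asm) AE_restrict_space_iff) auto
  then obtain N where N: "N \<in> null_sets lebesgue"
    "\<And>t. t \<notin> N \<Longrightarrow> t \<in> {s..} \<Longrightarrow> ((\<lambda>\<tau>. \<phi> s \<tau> z) has_vector_derivative G (\<phi> s t z) t) (at t within {s..})"
    by (auto elim!: AE_E3)
  show ?thesis
  proof (rule that)
    show "negligible N" using N(1) by (simp add: negligible_iff_null_sets)
    show "((\<lambda>\<tau>. \<phi> s \<tau> z) has_vector_derivative G (\<phi> s t z) t) (at t)" if "s < t" "t \<notin> N" for t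
      using N(2)[of t] that at_within_interior[of t "{s..}"] by simp
  qed
qed

section \<open>Time derivatives off a null set independent of the initial point\<close>

theorem theorem6p4:
  fixes d :: ennreal
    and \<phi> :: "real \<Rightarrow> real \<Rightarrow> complex \<Rightarrow> complex"
  assumes "1 \<le> d"
    and "evolution_family d \<phi>"
  shows
    "(\<forall>s\<ge>0. \<exists>M. M \<subseteq> {s..} \<and> M \<in> null_sets lebesgue \<and>
        (\<forall>t\<in>{s<..} - M. \<exists>f. f holomorphic_on unit_disc \<and>
           (\<forall>z\<in>unit_disc. ((\<lambda>h. (\<phi> s (t + h) z - \<phi> s t z) / complex_of_real h) \<longlongrightarrow> f z) (at 0)))) \<and>
     (\<forall>d' G. 1 \<le> d' \<and> herglotz_vector_field d' G \<and> positive_trajectories G \<phi> \<longrightarrow>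
        (\<forall>s\<ge>0. \<exists>M. M \<subseteq> {s..} \<and> M \<in> null_sets lebesgue \<and>
           (\<forall>t\<in>{s<..} - M. \<forall>z\<in>unit_disc.
              ((\<lambda>h. (\<phi> s (t + h) z - \<phi> s t z) / complex_of_real h) \<longlongrightarrow> G (\<phi> s t z) t) (at 0))))"
proof (intro conjI allI impI)
  fix s :: real assume s: "0 \<le> s"
  obtain N where N: "negligible N"
    "\<And>t. s < t \<Longrightarrow> t \<notin> N \<Longrightarrow> \<exists>f. f holomorphic_on unit_disc \<and>
      (\<forall>z\<in>unit_disc. ((\<lambda>\<tau>. \<phi> s \<tau> z) has_vector_derivative f z) (at t))"
    using time_derivative_holomorphic_ae[OF assms s] by blast
  have "N \<inter> {s..} \<in> null_sets lebesgue"
    using N(1) negligible_subset[of N "N \<inter> {s..}"] by (simp add: negligible_iff_null_sets)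
  then show "\<exists>M. M \<subseteq> {s..} \<and> M \<in> null_sets lebesgue \<and>
        (\<forall>t\<in>{s<..} - M. \<exists>f. f holomorphic_on unit_disc \<and>
           (\<forall>z\<in>unit_disc. ((\<lambda>h. (\<phi> s (t + h) z - \<phi> s t z) / complex_of_real h) \<longlongrightarrow> f z) (at 0)))"
    using N(2) by (intro exI[of _ "N \<inter> {s..}"]) (auto simp: has_vector_derivative_iff_complex_quotient)
next
  fix d' G and s :: real
  assume "1 \<le> d' \<and> herglotz_vector_field d' G \<and> positive_trajectories G \<phi>" and s: "0 \<le> s"
  then have G: "herglotz_vector_field d' G" and traj: "positive_trajectories G \<phi>" by auto
  obtain N where N: "negligible N"
    "\<And>t. s < t \<Longrightarrow> t \<notin> N \<Longrightarrow> \<exists>f. f holomorphic_on unit_disc \<and>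
      (\<forall>z\<in>unit_disc. ((\<lambda>\<tau>. \<phi> s \<tau> z) has_vector_derivative f z) (at t))"
    using time_derivative_holomorphic_ae[OF assms s] by blast
  obtain Q :: "complex set" where Q: "countable Q" "Q \<subseteq> unit_disc" "unit_disc \<subseteq> closure Q"
    using separable by blast
  have "\<exists>N. negligible N \<and> (\<forall>t>s. t \<notin> N \<longrightarrow> ((\<lambda>\<tau>. \<phi> s \<tau> q) has_vector_derivative G (\<phi> s t q) t) (at t))"
    if "q \<in> unit_disc" for q
    using trajectory_derivative_ae[OF traj that s] by blast
  then obtain N' where N': "\<And>q. q \<in> unit_disc \<Longrightarrow> negligible (N' q)"
    "\<And>q t. q \<in> unit_disc \<Longrightarrow> s < t \<Longrightarrow> t \<notin> N' q \<Longrightarrow>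
      ((\<lambda>\<tau>. \<phi> s \<tau> q) has_vector_derivative G (\<phi> s t q) t) (at t)"
    by metis
  \<comment> \<open>Off \<open>M\<close> the holomorphic derivative and \<open>z \<mapsto> G (\<phi> s t z) t\<close> agree on the dense set \<open>Q\<close>.\<close>
  define M where "M = (N \<union> (\<Union>q\<in>Q. N' q)) \<inter> {s..}"
  have "negligible (\<Union>q\<in>Q. N' q)"
    using Q N'(1) by (intro negligible_countable_Union) auto
  then have "negligible M"
    using N(1) negligible_Un negligible_subset unfolding M_def by (metis inf_le1)
  moreover have "((\<lambda>\<tau>. \<phi> s \<tau> z) has_vector_derivative G (\<phi> s t z) t) (at t)"
    if t: "t \<in> {s<..} - M" and z: "z \<in> unit_disc" for t z
  proof -
    have t': "s < t" "t \<notin> N" "\<And>q. q \<in> Q \<Longrightarrow> t \<notin> N' q" "0 \<le> t" using t s by (auto simp: M_def)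
    obtain f where f: "f holomorphic_on unit_disc"
      "\<And>z. z \<in> unit_disc \<Longrightarrow> ((\<lambda>\<tau>. \<phi> s \<tau> z) has_vector_derivative f z) (at t)"
      using N(2)[OF t'(1,2)] by blast
    have "holomorphic_self_map (\<phi> s t)" using assms(2) s t' by (simp add: evolution_family_def)
    moreover have "(\<lambda>z. G z t) holomorphic_on unit_disc"
      using G t' by (simp add: herglotz_vector_field_def weak_holomorphic_vector_field_def)
    ultimately have Gh: "(\<lambda>z. G (\<phi> s t z) t) holomorphic_on unit_disc"
      using holomorphic_on_compose_gen[of "\<phi> s t" unit_disc "\<lambda>z. G z t" unit_disc]
      by (simp add: holomorphic_self_map_def o_def)
    have eqQ: "f q = G (\<phi> s t q) t" if "q \<in> Q" for q
      using that Q(2) by (intro vector_derivative_unique_at[OF f(2) N'(2)] t') auto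
    have "f z = G (\<phi> s t z) t"
      by (rule holomorphic_eq_of_dense[OF f(1) Gh Q(2,3) eqQ z])
    then show ?thesis using f(2)[OF z] by simp
  qed
  moreover have "M \<subseteq> {s..}" by (simp add: M_def)
  ultimately show "\<exists>M. M \<subseteq> {s..} \<and> M \<in> null_sets lebesgue \<and>
           (\<forall>t\<in>{s<..} - M. \<forall>z\<in>unit_disc.
              ((\<lambda>h. (\<phi> s (t + h) z - \<phi> s t z) / complex_of_real h) \<longlongrightarrow> G (\<phi> s t z) t) (at 0))"
    by (intro exI[of _ M]) (simp add: negligible_iff_null_sets has_vector_derivative_iff_complex_quotient)
qed

end
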